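(* Let $T$ be a finite subset of $\mathbb{R}^d$ with $|T|\ge 3$, let $\mathcal{F}$ be a countable family of $2d$-variate real polynomials that respects $T$, and let $g$ and $k$ be positive integers. Then there exists a finite set $X\subset\mathbb{R}^d$ such that: (1) $\mathcal{F}$ respects $X$; (2) no tuple of fewer than $g$ homothetic copies of $T$ contained in $X$ forms a cycle (on $X$); (3) for every coloring of $X$ with $k$ colors, there is a monochromatic homothetic copy of $T$ contained in $X$.
   Context: A homothetic map in $\mathbb{R}^d$ is a map $h:\mathbb{R}^d\to\mathbb{R}^d$ of the form $h(p)=p^*+\lambda p$ for some $p^*\in\mathbb{R}^d$ and $\lambda>0$; a set $T'$ is a homothetic copy of $T$ if $T'=h(T)$ for some homothetic map $h$. A family $\mathcal{F}$ of $2d$-variate real polynomials respects a set $X\subset\mathbb{R}^d$ if $f(p,q)\neq 0$ for all $f\in\mathcal{F}$ and all pairs of distinct points $p,q\in X$. A cycle of length $\ell\ge 2$ on a set $X$ is a tuple $(T_1,\dots,T_\ell)$ of distinct subsets of $X$ such that there exist distinct elements $x_1,\dots,x_\ell\in X$ with $x_i\in T_i\cap T_{i+1}$ for $i\in[\ell-1]$ and $x_\ell\in T_\ell\cap T_1$. *)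

theory Defs
  imports "HOL-Analysis.Analysis" "HOL-Library.Poly_Mapping"
begin

(* A polynomial maps each monomial (a finitely supported exponent vector) to its coefficient. *)
type_synonym 'v real_poly = "('v \<Rightarrow>\<^sub>0 nat) \<Rightarrow>\<^sub>0 real"

definition real_poly_eval :: "'v real_poly \<Rightarrow> ('v \<Rightarrow> real) \<Rightarrow> real" where
  "real_poly_eval f a =
     (\<Sum>m\<in>Poly_Mapping.keys f.
        Poly_Mapping.lookup f m *
        (\<Prod>v\<in>Poly_Mapping.keys m. a v ^ Poly_Mapping.lookup m v))"

(* The 2d variables are indexed by the sum type 'n + 'n with CARD('n) = d:
   Inl i stands for the i-th coordinate of p, and Inr i for the i-th coordinate of q. *)
definition eval_at_pair :: "('n + 'n) real_poly \<Rightarrow> real ^ 'n \<Rightarrow> real ^ 'n \<Rightarrow> real" where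
  "eval_at_pair f p q = real_poly_eval f (case_sum (\<lambda>i. p $ i) (\<lambda>i. q $ i))"

definition respects_set :: "('n + 'n) real_poly set \<Rightarrow> (real ^ 'n) set \<Rightarrow> bool" where
  "respects_set F X \<longleftrightarrow>
     (\<forall>f\<in>F. \<forall>p\<in>X. \<forall>q\<in>X. p \<noteq> q \<longrightarrow> eval_at_pair f p q \<noteq> 0)"

definition homothetic_map :: "('a::real_vector \<Rightarrow> 'a) \<Rightarrow> bool" where
  "homothetic_map h \<longleftrightarrow> (\<exists>b l. l > 0 \<and> h = (\<lambda>p. b + l *\<^sub>R p))"

definition homothetic_copy :: "'a::real_vector set \<Rightarrow> 'a set \<Rightarrow> bool" where
  "homothetic_copy T T' \<longleftrightarrow> (\<exists>h. homothetic_map h \<and> T' = h ` T)"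

(* Tuples are lists, indexed from 0; the index modulo the length makes
   the last set meet the first one in the last point. *)
definition set_cycle :: "'a set \<Rightarrow> 'a set list \<Rightarrow> bool" where
  "set_cycle X Ts \<longleftrightarrow>
     length Ts \<ge> 2 \<and> distinct Ts \<and> (\<forall>T'\<in>set Ts. T' \<subseteq> X) \<and>
     (\<exists>xs. length xs = length Ts \<and> distinct xs \<and> set xs \<subseteq> X \<and>
        (\<forall>i<length Ts. xs ! i \<in> Ts ! i \<inter> Ts ! (Suc i mod length Ts)))"

end

theory Submission
  imports Defs
begin

text \<open>
  The theorem is reduced to a sparse Hales--Jewett theorem. If \<open>\<tau>\<close> enumerates \<open>T\<close>, a finite set \<open>X\<close> of
  words over \<open>{..<q}\<close>, \<open>q = |T|\<close>, is projected to \<open>\<real>\<^sup>d\<close> by \<open>x \<mapsto> \<Sum>i. w i * \<tau> (x i)\<close> with generic positive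
  weights. Each polynomial condition holds for some choice of weights, namely a unit vector at a
  coordinate where the two words differ, hence for generic weights. Combinatorial lines become
  homothetic copies of \<open>T\<close>; conversely, for generic weights a copy in the image is homothetic in each
  coordinate separately, so it comes from a set of \<open>q\<close> words on which every coordinate is constant or
  injective (a quasi-line).

  That finitely many quasi-lines have no short cycles follows from the inequality
  \<open>|\<Union>\<L>| \<ge> (q - 1) |\<L>| + 1\<close> for all nonempty families of at most \<open>g\<close> of them. The words are found by
  induction on \<open>g\<close> with the partite construction of Nesetril and Roedl: start from disjoint lifts of
  the lines of a Hales--Jewett set \<open>K\<close>, and for each \<open>v\<close> in \<open>K\<close> glue copies of the current system
  along its fibre over \<open>v\<close>, one copy for each line of a sparse Ramsey set whose alphabet is that
  fibre. Fibres meet quasi-lines in at most one point, so a family of \<open>m\<close> quasi-lines joins the copies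
  along at most \<open>m / 2\<close> of these lines in an essential way, and the induction hypothesis applies.
\<close>

section \<open>The Hales--Jewett theorem\<close>

text \<open>
  Words are infinite, but only finite sets of words occur; this allows coordinates to be recoded
  freely by bijections of \<open>nat\<close>.
\<close>
definition words :: "nat \<Rightarrow> (nat \<Rightarrow> nat) set" where
  "words q = {x. \<forall>i. x i < q}"

text \<open>The point at letter \<open>b\<close> of the combinatorial line with active coordinates
  \<open>A\<close> and fixed letters \<open>a\<close> elsewhere.\<close>

definition pt :: "nat set \<Rightarrow> (nat \<Rightarrow> nat) \<Rightarrow> nat \<Rightarrow> nat \<Rightarrow> nat" where
  "pt A a b = (\<lambda>i. if i \<in> A then b else a i)"

definition is_line :: "nat \<Rightarrow> (nat \<Rightarrow> nat) set \<Rightarrow> bool" where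
  "is_line q L \<longleftrightarrow> (\<exists>A a. A \<noteq> {} \<and> L = pt A a ` {..<q})"

definition mono_line :: "nat \<Rightarrow> ((nat \<Rightarrow> nat) \<Rightarrow> 'c) \<Rightarrow> (nat \<Rightarrow> nat) set \<Rightarrow> bool" where
  "mono_line q c X \<longleftrightarrow>
     (\<exists>A a j. A \<noteq> {} \<and> (\<forall>b<q. pt A a b \<in> X \<and> c (pt A a b) = j))"

definition line_ramsey :: "nat \<Rightarrow> nat \<Rightarrow> (nat \<Rightarrow> nat) set \<Rightarrow> bool" where
  "line_ramsey q k X \<longleftrightarrow>
     (\<forall>c :: (nat \<Rightarrow> nat) \<Rightarrow> nat. (\<forall>x\<in>X. c x < k) \<longrightarrow> mono_line q c X)"

text \<open>Interleaving replaces concatenation, which infinite words lack; it realizes products of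
  sets of words.\<close>

definition join :: "(nat \<Rightarrow> nat) \<Rightarrow> (nat \<Rightarrow> nat) \<Rightarrow> nat \<Rightarrow> nat" where
  "join x y = (\<lambda>i. if even i then x (i div 2) else y (i div 2))"

lemma mono_lineI:
  assumes "A \<noteq> {}" "\<And>b. b < q \<Longrightarrow> pt A a b \<in> X" "\<And>b. b < q \<Longrightarrow> c (pt A a b) = j"
  shows "mono_line q c X"
  using assms unfolding mono_line_def by blast

lemma mono_lineE:
  assumes "mono_line q c X"
  obtains A a j where "A \<noteq> {}" "\<And>b. b < q \<Longrightarrow> pt A a b \<in> X"
    "\<And>b. b < q \<Longrightarrow> c (pt A a b) = j"
  using assms unfolding mono_line_def by blast

lemma line_ramseyD:
  assumes "line_ramsey q k X" "\<And>x. x \<in> X \<Longrightarrow> c x < k"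
  shows "mono_line q c X"
  using assms unfolding line_ramsey_def by blast

text \<open>The colours are recoded injectively below \<open>k\<close>. The form is made for product
  colourings, whose colours are themselves functions.\<close>

lemma line_ramsey_colouring:
  assumes "line_ramsey q k X" "finite X" "card (c ` X) \<le> k" "0 < q"
  shows "mono_line q c X"
proof -
  have "\<exists>f. inj_on f (c ` X) \<and> f ` c ` X \<subseteq> {..<k}"
    using card_le_inj[of "c ` X" "{..<k}"] assms by auto
  then obtain f where f: "inj_on f (c ` X)" "f ` c ` X \<subseteq> {..<k}" by blast
  have "(f \<circ> c) x < k" if "x \<in> X" for x using f(2) that by auto
  then obtain A a j where A: "A \<noteq> {}" "\<And>b. b < q \<Longrightarrow> pt A a b \<in> X"
    "\<And>b. b < q \<Longrightarrow> (f \<circ> c) (pt A a b) = j"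
    using line_ramseyD[OF assms(1), of "f \<circ> c"] by (metis mono_lineE)
  have "c (pt A a b) = c (pt A a 0)" if "b < q" for b
    using A(2)[of b] A(2)[of 0] A(3)[of b] A(3)[of 0] f(1) that \<open>0 < q\<close>
    by (simp add: inj_on_def)
  then show ?thesis using A(1,2) by (rule mono_lineI[rotated 2])
qed

lemma join_pt:
  "join (pt A a b) (pt A' a' b) =
    pt {i. if even i then i div 2 \<in> A else i div 2 \<in> A'} (join a a') b"
  "join (pt A a b) y = pt {i. even i \<and> i div 2 \<in> A} (join a y) b"
  "join x (pt A' a' b) = pt {i. odd i \<and> i div 2 \<in> A'} (join x a') b"
  by (auto simp: join_def pt_def fun_eq_iff)

lemma join_pt_nonempty:
  assumes "A \<noteq> {}"
  shows "{i :: nat. if even i then i div 2 \<in> A else i div 2 \<in> A'} \<noteq> {}"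
    "{i :: nat. even i \<and> i div 2 \<in> A} \<noteq> {}" "{i :: nat. odd i \<and> i div 2 \<in> A} \<noteq> {}"
proof -
  obtain n where n: "n \<in> A" using assms by auto
  have "2 * n \<in> {i :: nat. if even i then i div 2 \<in> A else i div 2 \<in> A'}" using n by simp
  then show "{i :: nat. if even i then i div 2 \<in> A else i div 2 \<in> A'} \<noteq> {}" by blast
  have "2 * n \<in> {i :: nat. even i \<and> i div 2 \<in> A}" using n by simp
  then show "{i :: nat. even i \<and> i div 2 \<in> A} \<noteq> {}" by blast
  have "2 * n + 1 \<in> {i :: nat. odd i \<and> i div 2 \<in> A}" using n by simp
  then show "{i :: nat. odd i \<and> i div 2 \<in> A} \<noteq> {}" by blast
qed

text \<open>Colour focusing over the alphabet \<open>{..q}\<close>: the focus is the point of the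
  line at the new letter \<open>q\<close>.\<close>

definition focused ::
    "nat \<Rightarrow> ((nat \<Rightarrow> nat) \<Rightarrow> nat) \<Rightarrow> (nat \<Rightarrow> nat) set \<Rightarrow> (nat \<Rightarrow> nat) \<Rightarrow> nat \<Rightarrow> bool" where
  "focused q c X f \<gamma> \<longleftrightarrow>
     (\<exists>A a. A \<noteq> {} \<and> pt A a q = f \<and> (\<forall>b\<le>q. pt A a b \<in> X) \<and> (\<forall>b<q. c (pt A a b) = \<gamma>))"

lemma focusedI:
  assumes "A \<noteq> {}" "pt A a q = f" "\<And>b. b \<le> q \<Longrightarrow> pt A a b \<in> X"
    "\<And>b. b < q \<Longrightarrow> c (pt A a b) = \<gamma>"
  shows "focused q c X f \<gamma>"
  using assms unfolding focused_def by blast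

lemma focusedE:
  assumes "focused q c X f \<gamma>"
  obtains A a where "A \<noteq> {}" "pt A a q = f" "\<And>b. b \<le> q \<Longrightarrow> pt A a b \<in> X"
    "\<And>b. b < q \<Longrightarrow> c (pt A a b) = \<gamma>"
  using assms unfolding focused_def by blast

lemma focused_mono_line:
  assumes "focused q c X f (c f)"
  shows "mono_line (Suc q) c X"
proof -
  obtain A a where A: "A \<noteq> {}" "pt A a q = f" "\<And>b. b \<le> q \<Longrightarrow> pt A a b \<in> X"
    "\<And>b. b < q \<Longrightarrow> c (pt A a b) = c f"
    using assms by (rule focusedE) blast
  then show ?thesis by (intro mono_lineI[of A _ a _ _ "c f"]) (auto simp: less_Suc_eq)
qed

text \<open>Induction on \<open>r\<close>. The new set is a product of \<open>X\<close> with a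
  Hales--Jewett set over \<open>q\<close> letters, whose words are coloured by the colourings they
  induce on \<open>X\<close>; this is why the hypothesis covers every number of colours.\<close>

lemma Hales_Jewett_focus:
  assumes IH: "\<And>k. \<exists>X. finite X \<and> X \<subseteq> words q \<and> line_ramsey q k X" and "2 \<le> q"
  shows "\<exists>X. finite X \<and> X \<subseteq> words (Suc q) \<and>
    (\<forall>c. (\<forall>x\<in>X. c x < k) \<longrightarrow> mono_line (Suc q) c X \<or>
      (\<exists>f\<in>X. \<exists>C. finite C \<and> card C = r \<and> (\<forall>\<gamma>\<in>C. focused q c X f \<gamma>)))"
proof (induction r)
  case 0
  show ?case
    by (rule exI[of _ "{\<lambda>_. 0}"]) (auto simp: words_def intro!: exI[of _ "{}"])
next
  case (Suc r)
  then obtain X where X: "finite X" "X \<subseteq> words (Suc q)" and XR: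
    "\<And>c. (\<forall>x\<in>X. c x < k) \<Longrightarrow> mono_line (Suc q) c X \<or>
      (\<exists>f\<in>X. \<exists>C. finite C \<and> card C = r \<and> (\<forall>\<gamma>\<in>C. focused q c X f \<gamma>))"
    by blast
  obtain Y where Y: "finite Y" "Y \<subseteq> words q" "line_ramsey q (k ^ card X) Y"
    using IH by blast
  \<comment> \<open>The points at letters 0 and 1 of a line determine its active coordinates, hence
    its point at the new letter \<open>q\<close>; \<open>Y'\<close> contains all such
    endpoints.\<close>
  define top where "top = (\<lambda>(x, y) (i :: nat). if x i \<noteq> y i then q else x i)"
  define Y' where "Y' = Y \<union> top ` (Y \<times> Y)"
  define Z where "Z = (\<lambda>(y, x). join y x) ` (Y' \<times> X)"
  have Zi: "join y x \<in> Z" if "y \<in> Y'" "x \<in> X" for x y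
    using that unfolding Z_def by (force simp: image_iff)
  have "finite Z" using X Y unfolding Z_def Y'_def by auto
  moreover have "Z \<subseteq> words (Suc q)"
  proof -
    have "Y' \<subseteq> words (Suc q)"
      using Y(2) unfolding Y'_def top_def words_def by (fastforce simp: less_Suc_eq)
    then show ?thesis using X unfolding Z_def words_def join_def by (auto simp: subset_iff)
  qed
  moreover have "mono_line (Suc q) c Z \<or>
      (\<exists>f\<in>Z. \<exists>C. finite C \<and> card C = Suc r \<and> (\<forall>\<gamma>\<in>C. focused q c Z f \<gamma>))"
    if c: "\<forall>x\<in>Z. c x < k" for c
  proof -
    \<comment> \<open>\<open>restrict\<close> leaves at most \<open>k ^ card X\<close> values, so
      the Ramsey property of \<open>Y\<close> applies.\<close>
    define c' where "c' = (\<lambda>y. restrict (\<lambda>x. c (join y x)) X)"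
    have "c' ` Y \<subseteq> X \<rightarrow>\<^sub>E {..<k}"
      using c Zi unfolding c'_def Y'_def by (auto simp: PiE_iff)
    moreover have "card (X \<rightarrow>\<^sub>E {..<k}) = k ^ card X" "finite (X \<rightarrow>\<^sub>E {..<k})"
      using X by (simp_all add: card_PiE finite_PiE)
    ultimately have "card (c' ` Y) \<le> k ^ card X"
      by (metis card_mono)
    then have "mono_line q c' Y"
      using line_ramsey_colouring[OF Y(3,1)] \<open>2 \<le> q\<close> by simp
    then obtain A a j where A: "A \<noteq> {}" "\<And>b. b < q \<Longrightarrow> pt A a b \<in> Y"
      "\<And>b. b < q \<Longrightarrow> c' (pt A a b) = j"
      by (rule mono_lineE) blast
    have "pt A a q = top (pt A a 0, pt A a 1)"
      by (auto simp: top_def pt_def)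
    then have "pt A a q \<in> Y'" using A(2)[of 0] A(2)[of 1] \<open>2 \<le> q\<close> unfolding Y'_def by auto
    then have ptY: "pt A a b \<in> Y'" if "b \<le> q" for b
      using that A(2) unfolding Y'_def le_less by blast
    \<comment> \<open>Along the first \<open>q\<close> points of the line in \<open>Y\<close> the
      colour depends on the second factor only.\<close>
    define \<kappa> where "\<kappa> = (\<lambda>x. c (join (pt A a 0) x))"
    have \<kappa>: "c (join (pt A a b) x) = \<kappa> x" if "b < q" "x \<in> X" for b x
    proof -
      have "c' (pt A a b) x = c' (pt A a 0) x" using A(3)[of b] A(3)[of 0] that by simp
      then show ?thesis using that unfolding c'_def \<kappa>_def by simp
    qed
    have mono: "mono_line (Suc q) c Z" if M: "mono_line (Suc q) \<kappa> X"
    proof -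
      obtain B b j where B: "B \<noteq> {}" "\<And>i. i < Suc q \<Longrightarrow> pt B b i \<in> X"
        "\<And>i. i < Suc q \<Longrightarrow> \<kappa> (pt B b i) = j"
        using M by (rule mono_lineE) blast
      show ?thesis
        by (rule mono_lineI[OF join_pt_nonempty(3)[OF B(1)], of _ "join (pt A a 0) b" _ _ j];
            subst join_pt(3)[symmetric]) (use B Zi ptY in \<open>auto simp: \<kappa>_def\<close>)
    qed
    have "\<forall>x\<in>X. \<kappa> x < k" using c Zi ptY unfolding \<kappa>_def by simp
    from XR[OF this] show ?thesis
    proof
      assume "mono_line (Suc q) \<kappa> X"
      then show ?thesis using mono by blast
    next
      assume "\<exists>f\<in>X. \<exists>C. finite C \<and> card C = r \<and> (\<forall>\<gamma>\<in>C. focused q \<kappa> X f \<gamma>)"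
      then obtain f C where f: "f \<in> X" "finite C" "card C = r" and
        C: "\<And>\<gamma>. \<gamma> \<in> C \<Longrightarrow> focused q \<kappa> X f \<gamma>" by blast
      show ?thesis
      proof (cases "\<kappa> f \<in> C")
        case True
        then show ?thesis using focused_mono_line[OF C] mono by blast
      next
        case False
        \<comment> \<open>Moving along both lines at once keeps each focused colour; moving in the
          first factor only, over \<open>f\<close>, adds the new colour \<open>\<kappa> f\<close>.
          All these lines share the focus \<open>?f\<close>.\<close>
        let ?f = "join (pt A a q) f"
        have "focused q c Z ?f \<gamma>" if \<gamma>: "\<gamma> \<in> C" for \<gamma>
        proof -
          obtain B b where B: "B \<noteq> {}" "pt B b q = f" "\<And>i. i \<le> q \<Longrightarrow> pt B b i \<in> X"
            "\<And>i. i < q \<Longrightarrow> \<kappa> (pt B b i) = \<gamma>"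
            using C[OF \<gamma>] by (rule focusedE) blast
          show ?thesis
            by (rule focusedI[OF join_pt_nonempty(1)[OF A(1)], of B "join a b"];
                subst join_pt(1)[symmetric]) (use B Zi ptY \<kappa> in auto)
        qed
        moreover have "focused q c Z ?f (\<kappa> f)"
          by (rule focusedI[OF join_pt_nonempty(2)[OF A(1)], of "join a f"];
                subst join_pt(2)[symmetric]) (use f Zi ptY \<kappa> in auto)
        moreover have "?f \<in> Z" using Zi ptY f(1) by simp
        moreover have "finite (insert (\<kappa> f) C)" "card (insert (\<kappa> f) C) = Suc r"
          using f False by simp_all
        ultimately show ?thesis by (metis insert_iff)
      qed
    qed
  qed
  ultimately show ?case by (intro exI[of _ Z]) blast
qed

text \<open>Induction on the alphabet. Focused lines in \<open>k + 1\<close> distinct colours cannot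
  exist, so \<open>Hales_Jewett_focus\<close> with \<open>r = k + 1\<close> leaves only a
  monochromatic line.\<close>

theorem Hales_Jewett:
  assumes "2 \<le> q"
  shows "\<exists>X. finite X \<and> X \<subseteq> words q \<and> line_ramsey q k X"
  using assms
proof (induction q arbitrary: k rule: nat_induct_at_least)
  case base
  \<comment> \<open>Of these \<open>k + 1\<close> threshold words two get the same colour; for
    \<open>m < n\<close> they are the two points of a line with active set
    \<open>{m..<n}\<close>.\<close>
  define w where "w = (\<lambda>m (i :: nat). if i < m then 1 else 0 :: nat)"
  have "line_ramsey 2 k (w ` {..k})"
    unfolding line_ramsey_def
  proof (intro allI impI)
    fix c :: "(nat \<Rightarrow> nat) \<Rightarrow> nat"
    assume c: "\<forall>x\<in>w ` {..k}. c x < k"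
    have "\<not> inj_on (c \<circ> w) {..k}"
      using card_inj_on_le[of "c \<circ> w" "{..k}" "{..<k}"] c by auto
    then obtain m n where mn: "m \<le> k" "n \<le> k" "c (w m) = c (w n)" "m < n"
      unfolding inj_on_def by (metis atMost_iff comp_apply nat_neq_iff)
    have *: "pt {m..<n} (w m) b = (if b = 0 then w m else w n)" if "b < 2" for b
      using mn(4) that by (auto simp: pt_def w_def less_2_cases_iff)
    show "mono_line 2 c (w ` {..k})"
      by (rule mono_lineI[of "{m..<n}" _ "w m" _ _ "c (w m)"]) (use mn * in auto)
  qed
  moreover have "w ` {..k} \<subseteq> words 2" by (auto simp: words_def w_def)
  ultimately show ?case by blast
next
  case (Suc q)
  obtain X where X: "finite X" "X \<subseteq> words (Suc q)" and XR:
    "\<And>c. (\<forall>x\<in>X. c x < k) \<Longrightarrow> mono_line (Suc q) c X \<or>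
      (\<exists>f\<in>X. \<exists>C. finite C \<and> card C = Suc k \<and> (\<forall>\<gamma>\<in>C. focused q c X f \<gamma>))"
    using Hales_Jewett_focus[of q k "Suc k", OF Suc.IH Suc.hyps] by blast
  have "mono_line (Suc q) c X" if c: "\<forall>x\<in>X. c x < k" for c :: "(nat \<Rightarrow> nat) \<Rightarrow> nat"
  proof -
    have False if C: "finite C" "card C = Suc k" "\<forall>\<gamma>\<in>C. focused q c X f \<gamma>" for C f
    proof -
      have "C \<subseteq> {..<k}"
      proof
        fix \<gamma> assume "\<gamma> \<in> C"
        then have "focused q c X f \<gamma>" using C(3) by blast
        then obtain A a where "\<And>b. b \<le> q \<Longrightarrow> pt A a b \<in> X" "\<And>b. b < q \<Longrightarrow> c (pt A a b) = \<gamma>"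
          by (rule focusedE) blast
        from this[of 0] show "\<gamma> \<in> {..<k}" using c Suc.hyps by auto
      qed
      then show False using card_mono[of "{..<k}" C] C(2) by simp
    qed
    then show ?thesis using XR[OF c] by blast
  qed
  then show ?case using X unfolding line_ramsey_def by blast
qed

section \<open>Quasi-lines and sparse sets\<close>

definition qline :: "nat \<Rightarrow> (nat \<Rightarrow> nat) set \<Rightarrow> bool" where
  "qline q L \<longleftrightarrow>
     card L = q \<and> (\<forall>i. (\<forall>x\<in>L. \<forall>y\<in>L. x i = y i) \<or> inj_on (\<lambda>x. x i) L)"

text \<open>The union of the \<open>m\<close> sets of size \<open>q\<close> on a cycle has at most \<open>(q - 1) m\<close> points.\<close>
definition sparse :: "nat \<Rightarrow> nat \<Rightarrow> (nat \<Rightarrow> nat) set \<Rightarrow> bool" where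
  "sparse q g X \<longleftrightarrow>
     (\<forall>\<L>. finite \<L> \<and> \<L> \<noteq> {} \<and> card \<L> \<le> g \<and> (\<forall>L\<in>\<L>. L \<subseteq> X \<and> qline q L) \<longrightarrow>
        (q - 1) * card \<L> + 1 \<le> card (\<Union>\<L>))"

text \<open>The embeddings of the partite construction: each coordinate is copied or constant, so
  that lines go to lines or to points.\<close>

definition subst_map :: "((nat \<Rightarrow> nat) \<Rightarrow> nat \<Rightarrow> nat) \<Rightarrow> bool" where
  "subst_map h \<longleftrightarrow> (\<forall>i. (\<exists>j. \<forall>x. h x i = x j) \<or> (\<exists>c. \<forall>x. h x i = c))"

lemma sparseD:
  assumes "sparse q g X" "finite \<L>" "\<L> \<noteq> {}" "card \<L> \<le> g"
    "\<And>L. L \<in> \<L> \<Longrightarrow> L \<subseteq> X" "\<And>L. L \<in> \<L> \<Longrightarrow> qline q L"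
  shows "(q - 1) * card \<L> + 1 \<le> card (\<Union>\<L>)"
  using assms unfolding sparse_def by blast

lemma card_ge_3_third:
  assumes "3 \<le> card M"
  obtains z where "z \<in> M" "z \<noteq> x" "z \<noteq> y"
proof -
  have "finite M" using assms by (metis card.infinite not_numeral_le_zero)
  have "\<not> M \<subseteq> {x, y}"
  proof
    assume "M \<subseteq> {x, y}"
    then have "card M \<le> card {x, y}" by (intro card_mono) auto
    also have "\<dots> \<le> 2" by (simp add: card_insert_if)
    finally show False using assms by simp
  qed
  then show thesis using that by blast
qed

lemma inj_pt:
  assumes "A \<noteq> {}"
  shows "inj (pt A a)"
proof (rule injI)
  fix b b' assume *: "pt A a b = pt A a b'"
  obtain i where "i \<in> A" using assms by auto
  then show "b = b'" using fun_cong[OF *, of i] by (simp add: pt_def)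
qed

lemma qline_line:
  assumes "is_line q L"
  shows "qline q L"
proof -
  obtain A a where A: "A \<noteq> {}" "L = pt A a ` {..<q}"
    using assms unfolding is_line_def by blast
  have "card L = q"
    unfolding A(2) using card_image[OF inj_on_subset[OF inj_pt[OF A(1)]], of "{..<q}"] by simp
  moreover have "(\<forall>x\<in>L. \<forall>y\<in>L. x i = y i) \<or> inj_on (\<lambda>x. x i) L" for i
    unfolding A(2) by (cases "i \<in> A") (auto simp: pt_def inj_on_def)
  ultimately show ?thesis unfolding qline_def by blast
qed

text \<open>A selected coordinate that is not constant is injective on \<open>M\<close>, so it
  already separates all points. Applied, also through \<open>qline_const\<close>, to the parts of a
  word selected by \<open>pr\<close>, \<open>sub\<close> and \<open>blk\<close>.\<close>

lemma qline_reindex: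
  fixes \<sigma> :: "nat \<Rightarrow> nat"
  assumes "qline q M"
  shows "(\<forall>x\<in>M. \<forall>y\<in>M. x \<circ> \<sigma> = y \<circ> \<sigma>) \<or>
    (inj_on (\<lambda>x. x \<circ> \<sigma>) M \<and> qline q ((\<lambda>x. x \<circ> \<sigma>) ` M))"
proof (cases "\<forall>x\<in>M. \<forall>y\<in>M. x \<circ> \<sigma> = y \<circ> \<sigma>")
  case False
  then obtain x y i where "x \<in> M" "y \<in> M" "x (\<sigma> i) \<noteq> y (\<sigma> i)"
    by (auto simp: fun_eq_iff)
  then have "inj_on (\<lambda>x. x (\<sigma> i)) M"
    using assms unfolding qline_def by blast
  then have inj: "inj_on (\<lambda>x. x \<circ> \<sigma>) M"
    unfolding inj_on_def by (metis comp_apply)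
  moreover have "qline q ((\<lambda>x. x \<circ> \<sigma>) ` M)"
    unfolding qline_def
  proof (intro conjI allI)
    show "card ((\<lambda>x. x \<circ> \<sigma>) ` M) = q"
      using card_image[OF inj] assms unfolding qline_def by simp
    fix j
    have "(\<forall>x\<in>M. \<forall>y\<in>M. x (\<sigma> j) = y (\<sigma> j)) \<or> inj_on (\<lambda>x. x (\<sigma> j)) M"
      using assms unfolding qline_def by blast
    then show "(\<forall>x\<in>(\<lambda>x. x \<circ> \<sigma>) ` M. \<forall>y\<in>(\<lambda>x. x \<circ> \<sigma>) ` M. x j = y j) \<or>
        inj_on (\<lambda>x. x j) ((\<lambda>x. x \<circ> \<sigma>) ` M)"
    proof
      assume inj: "inj_on (\<lambda>x. x (\<sigma> j)) M"
      have "inj_on (\<lambda>x. x j) ((\<lambda>x. x \<circ> \<sigma>) ` M)"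
        by (rule inj_onI) (use inj_onD[OF inj] in fastforce)
      then show ?thesis ..
    qed simp
  qed
  ultimately show ?thesis by blast
qed blast

lemma qline_const:
  fixes \<sigma> :: "nat \<Rightarrow> nat"
  assumes "qline q M" "x \<in> M" "y \<in> M" "x \<noteq> y" "x \<circ> \<sigma> = y \<circ> \<sigma>" "z \<in> M"
  shows "z \<circ> \<sigma> = x \<circ> \<sigma>"
  using qline_reindex[OF assms(1), of \<sigma>] assms(2-6) unfolding inj_on_def by blast

lemma qline_const_at:
  assumes "qline q M" "x \<in> M" "y \<in> M" "x \<noteq> y" "x i = y i" "z \<in> M"
  shows "z i = x i"
  using assms unfolding qline_def inj_on_def by blast

text \<open>Every coordinate of a point survives as some coordinate of its image, so the dichotomy
  transfers back.\<close>

lemma qline_preimage: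
  assumes "qline q (h ` M)" "inj_on h M" "\<And>i. \<exists>j. \<forall>x\<in>M. h x j = x i"
  shows "qline q M"
  unfolding qline_def
proof (intro conjI allI)
  show "card M = q" using assms(1,2) card_image[of h M] unfolding qline_def by simp
  fix i
  obtain j where j: "\<forall>x\<in>M. h x j = x i" using assms(3) by blast
  have "(\<forall>x\<in>h ` M. \<forall>y\<in>h ` M. x j = y j) \<or> inj_on (\<lambda>x. x j) (h ` M)"
    using assms(1) unfolding qline_def by blast
  then show "(\<forall>x\<in>M. \<forall>y\<in>M. x i = y i) \<or> inj_on (\<lambda>x. x i) M"
  proof
    assume "inj_on (\<lambda>x. x j) (h ` M)"
    then have "inj_on ((\<lambda>x. x j) \<circ> h) M" using assms(2) by (rule comp_inj_on[rotated])
    moreover have "inj_on ((\<lambda>x. x j) \<circ> h) M \<longleftrightarrow> inj_on (\<lambda>x. x i) M"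
      using j by (intro inj_on_cong) simp
    ultimately show ?thesis by blast
  qed (use j in auto)
qed

text \<open>
  The points of a full quasi-line take every letter in a non-constant coordinate, so a missing
  point is determined by the others.
\<close>
lemma qline_copy_coordinate:
  assumes M: "qline q M" "3 \<le> q" "M \<subseteq> words q" and x: "x \<in> M"
    and eq: "\<And>y. y \<in> M \<Longrightarrow> y \<noteq> x \<Longrightarrow> y i = y j"
  shows "x i = x j"
proof -
  have card: "card M = q" using M unfolding qline_def by blast
  then have fin: "finite M" using M(2) by (metis card.infinite not_numeral_le_zero)
  obtain y where y: "y \<in> M" "y \<noteq> x" using card_ge_3_third[of M x x] card M(2) by metis
  obtain z where z: "z \<in> M" "z \<noteq> x" "z \<noteq> y" using card_ge_3_third[of M x y] card M(2) by metis
  \<comment> \<open>The two further points \<open>y\<close> and \<open>z\<close> decide whether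
    coordinate \<open>i\<close>, and with it \<open>j\<close>, is constant on
    \<open>M\<close>.\<close>
  show ?thesis
  proof (cases "y i = z i")
    case True
    then have "y j = z j" using eq y z by metis
    then have "x j = y j" using qline_const_at[OF M(1) y(1) z(1)] z x by blast
    moreover have "x i = y i" using qline_const_at[OF M(1) y(1) z(1)] z x True by blast
    ultimately show ?thesis using eq y by simp
  next
    case False
    then have "y j \<noteq> z j" using eq y z by metis
    have full: "(\<lambda>x. x l) ` M = {..<q} \<and> inj_on (\<lambda>x. x l) M" if "y l \<noteq> z l" for l
    proof -
      have inj: "inj_on (\<lambda>x. x l) M" using M(1) that y z unfolding qline_def by blast
      then have "card ((\<lambda>x. x l) ` M) = card {..<q}" using card_image[OF inj] card by simp
      moreover have "(\<lambda>x. x l) ` M \<subseteq> {..<q}" using M(3) by (auto simp: words_def)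
      ultimately show ?thesis using inj by (simp add: card_subset_eq)
    qed
    have "x l \<notin> (\<lambda>x. x l) ` (M - {x})" "insert (x l) ((\<lambda>x. x l) ` (M - {x})) = {..<q}"
      if "y l \<noteq> z l" for l
      using full[OF that] x unfolding inj_on_def by auto
    from this[OF False] this[OF \<open>y j \<noteq> z j\<close>]
    have "x i \<notin> (\<lambda>x. x i) ` (M - {x})" "x j \<notin> (\<lambda>x. x j) ` (M - {x})"
      "insert (x i) ((\<lambda>x. x i) ` (M - {x})) = insert (x j) ((\<lambda>x. x j) ` (M - {x}))"
      by auto
    moreover have "(\<lambda>x. x i) ` (M - {x}) = (\<lambda>x. x j) ` (M - {x})"
      using eq by (intro image_cong) auto
    ultimately show ?thesis by (metis insert_iff)
  qed
qed

text \<open>The overlap of a family, the sum of the sizes minus the size of the union, can only grow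
  with the sets: each added set contributes its intersection with the previous union.\<close>

lemma card_Union_shrink:
  assumes "finite R" "\<And>e. e \<in> R \<Longrightarrow> finite (W e)" "\<And>e. e \<in> R \<Longrightarrow> V e \<subseteq> W e"
  shows "card (\<Union>e\<in>R. W e) + (\<Sum>e\<in>R. card (V e)) \<le> card (\<Union>e\<in>R. V e) + (\<Sum>e\<in>R. card (W e))"
  using assms
proof (induction R rule: finite_induct)
  case (insert e R)
  let ?W = "\<Union>e\<in>R. W e" and ?V = "\<Union>e\<in>R. V e"
  have fin: "finite (W e)" "finite (V e)" "finite ?W" "finite ?V" "?V \<subseteq> ?W"
    using insert.hyps insert.prems by (auto intro: finite_subset)
  have "card (W e \<union> ?W) + card (W e \<inter> ?W) = card (W e) + card ?W"
    "card (V e \<union> ?V) + card (V e \<inter> ?V) = card (V e) + card ?V"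
    using fin card_Un_Int by metis+
  moreover have "card (V e \<inter> ?V) \<le> card (W e \<inter> ?W)"
    using fin insert.prems by (intro card_mono) auto
  moreover have "card ?W + (\<Sum>e\<in>R. card (V e)) \<le> card ?V + (\<Sum>e\<in>R. card (W e))"
    using insert by auto
  ultimately show ?case using insert.hyps by simp
qed simp

text \<open>
  The sets \<open>U e\<close> overlap only inside \<open>N\<close>, where they are parts of the edges \<open>W e\<close> of a sparse
  system. An edge with two points in \<open>N\<close> has weight at least 2, which halves the number of edges
  to which sparseness has to be applied.
\<close>
lemma card_Union_amalgam:
  fixes m :: "'e \<Rightarrow> nat"
  assumes R: "finite R" "R \<noteq> {}"
    and fin: "\<And>e. e \<in> R \<Longrightarrow> finite (U e)" "\<And>e. e \<in> R \<Longrightarrow> finite (W e)"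
    and disj: "\<And>e e'. e \<in> R \<Longrightarrow> e' \<in> R \<Longrightarrow> e \<noteq> e' \<Longrightarrow> U e \<inter> U e' \<subseteq> N"
    and UW: "\<And>e. e \<in> R \<Longrightarrow> U e \<inter> N \<subseteq> W e"
    and W: "\<And>e. e \<in> R \<Longrightarrow> card (W e) = s" "1 \<le> s"
    and sp: "\<And>R'. R' \<subseteq> R \<Longrightarrow> R' \<noteq> {} \<Longrightarrow> card R' \<le> g \<Longrightarrow>
      (s - 1) * card R' + 1 \<le> card (\<Union>e\<in>R'. W e)"
    and m: "\<And>e. e \<in> R \<Longrightarrow> card (U e \<inter> N) \<le> m e" "(\<Sum>e\<in>R. m e) \<le> Suc g"
      "\<And>e. e \<in> R \<Longrightarrow> (q - 1) * m e + 1 \<le> card (U e)"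
  shows "(q - 1) * (\<Sum>e\<in>R. m e) + 1 \<le> card (\<Union>e\<in>R. U e)"
proof -
  define V where "V = (\<lambda>e. U e \<inter> N)"
  have finV: "finite (V e)" if "e \<in> R" for e using fin that by (simp add: V_def)
  define R2 where "R2 = {e \<in> R. 2 \<le> card (V e)}"
  have R2: "R2 \<subseteq> R" "finite R2" using R by (auto simp: R2_def)
  have "2 * card R2 = (\<Sum>e\<in>R2. 2)" by simp
  also have "\<dots> \<le> (\<Sum>e\<in>R2. card (V e))" by (rule sum_mono) (simp add: R2_def)
  also have "\<dots> \<le> (\<Sum>e\<in>R2. m e)" using m(1) R2 by (intro sum_mono) (auto simp: V_def)
  also have "\<dots> \<le> (\<Sum>e\<in>R. m e)" using R R2 by (intro sum_mono2) auto
  finally have "2 * card R2 \<le> Suc g" using m(2) by simp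
  then have r2: "card R2 \<le> g" by linarith
  have small: "card (V e) \<le> 1" if "e \<in> R - R2" for e using that by (auto simp: R2_def)
  \<comment> \<open>The inequality of a hypergraph forest for the traces \<open>V e\<close>. Edges
    outside \<open>R2\<close> have at most one point and cannot spoil it; if \<open>R2\<close> is
    empty, the summand 1 is paid for by a nonempty trace or, if all traces are empty, by the
    nonempty \<open>R\<close>.\<close>
  have V: "(\<Sum>e\<in>R. card (V e)) + 1 \<le> card (\<Union>e\<in>R. V e) + card R"
  proof (cases "R2 = {}")
    case True
    have le: "(\<Sum>e\<in>R. card (V e)) \<le> card R"
      using sum_mono[of R "\<lambda>e. card (V e)" "\<lambda>_. 1"] small True by simp
    show ?thesis
    proof (cases "\<exists>e\<in>R. V e \<noteq> {}")
      case True
      then have "(\<Union>e\<in>R. V e) \<noteq> {}" "finite (\<Union>e\<in>R. V e)" using R finV by auto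
      then have "card (\<Union>e\<in>R. V e) > 0" by (simp add: card_gt_0_iff)
      then show ?thesis using le by simp
    next
      case False
      then have "(\<Sum>e\<in>R. card (V e)) = 0" by simp
      moreover have "card R > 0" using R by (simp add: card_gt_0_iff)
      ultimately show ?thesis by simp
    qed
  next
    case False
    have "card (\<Union>e\<in>R2. W e) + (\<Sum>e\<in>R2. card (V e)) \<le>
        card (\<Union>e\<in>R2. V e) + (\<Sum>e\<in>R2. card (W e))"
    proof (rule card_Union_shrink)
      show "finite (W e)" "V e \<subseteq> W e" if "e \<in> R2" for e
        using fin(2) UW R2(1) that unfolding V_def by blast+
    qed (use R2 in auto)
    moreover have "(\<Sum>e\<in>R2. card (W e)) = (\<Sum>e\<in>R2. s)" using W R2 by (intro sum.cong) auto
    then have "(\<Sum>e\<in>R2. card (W e)) = (s - 1) * card R2 + card R2"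
      using W(2) by (cases s) auto
    moreover note sp[OF R2(1) False r2]
    ultimately have *: "(\<Sum>e\<in>R2. card (V e)) + 1 \<le> card (\<Union>e\<in>R2. V e) + card R2"
      by linarith
    have "(\<Sum>e\<in>R. card (V e)) = (\<Sum>e\<in>R - R2. card (V e)) + (\<Sum>e\<in>R2. card (V e))"
      using R R2 by (intro sum.subset_diff) auto
    moreover have "(\<Sum>e\<in>R - R2. card (V e)) \<le> card (R - R2)"
      using sum_mono[of "R - R2" "\<lambda>e. card (V e)" "\<lambda>_. 1"] small by simp
    moreover have "card (R - R2) + card R2 = card R"
      using R R2 by (metis card_Diff_subset card_mono le_add_diff_inverse2)
    moreover have "card (\<Union>e\<in>R2. V e) \<le> card (\<Union>e\<in>R. V e)"
      using R R2 finV by (intro card_mono) auto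
    ultimately show ?thesis using * by linarith
  qed
  \<comment> \<open>Outside \<open>N\<close> the sets \<open>U e\<close> are disjoint. The summands
    1 in the bounds for \<open>card (U e)\<close> add up to \<open>card R\<close>, the term that
    occurs in \<open>V\<close>.\<close>
  have "(\<Union>e\<in>R. U e) = (\<Union>e\<in>R. U e - N) \<union> (\<Union>e\<in>R. V e)" by (auto simp: V_def)
  moreover have "card ((\<Union>e\<in>R. U e - N) \<union> (\<Union>e\<in>R. V e)) =
      card (\<Union>e\<in>R. U e - N) + card (\<Union>e\<in>R. V e)"
    using R fin by (intro card_Un_disjoint) (auto simp: V_def)
  moreover have "card (\<Union>e\<in>R. U e - N) = (\<Sum>e\<in>R. card (U e - N))"
    using R fin disj by (intro card_UN_disjoint) (auto simp: disjoint_iff subset_iff)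
  moreover have "(\<Sum>e\<in>R. card (U e)) = (\<Sum>e\<in>R. card (U e - N) + card (V e))"
  proof (rule sum.cong)
    fix e assume "e \<in> R"
    then have "card (U e - N) + card (V e) = card ((U e - N) \<union> V e)"
      using fin by (subst card_Un_disjoint) (auto simp: V_def)
    moreover have "(U e - N) \<union> V e = U e" by (auto simp: V_def)
    ultimately show "card (U e) = card (U e - N) + card (V e)" by simp
  qed simp
  moreover have "(\<Sum>e\<in>R. (q - 1) * m e + 1) \<le> (\<Sum>e\<in>R. card (U e))"
    using m(3) by (rule sum_mono)
  moreover have "(\<Sum>e\<in>R. (q - 1) * m e + 1) = (q - 1) * (\<Sum>e\<in>R. m e) + card R"
    by (simp only: sum_distrib_left sum.distrib) simp
  ultimately show ?thesis using V by (simp add: sum.distrib)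
qed

section \<open>Substitution maps and combinatorial lines\<close>

lemma subst_map_id: "subst_map id"
  unfolding subst_map_def by auto

lemma subst_map_comp:
  assumes "subst_map h" "subst_map h'"
  shows "subst_map (h' \<circ> h)"
  unfolding subst_map_def
proof
  fix i
  consider j where "\<forall>x. h' x i = x j" | c where "\<forall>x. h' x i = c"
    using assms(2) unfolding subst_map_def by blast
  then show "(\<exists>j. \<forall>x. (h' \<circ> h) x i = x j) \<or> (\<exists>c. \<forall>x. (h' \<circ> h) x i = c)"
  proof cases
    case (1 j)
    have "(\<exists>l. \<forall>x. h x j = x l) \<or> (\<exists>c. \<forall>x. h x j = c)"
      using assms(1) unfolding subst_map_def by blast
    then show ?thesis using 1 by simp
  qed auto
qed

text \<open>Active in the image are the coordinates copied from an active one; these are the ones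
  where the images at letters 0 and 1 differ, so some exist.\<close>

lemma subst_map_pt:
  assumes "subst_map h" "h (pt A a 0) \<noteq> h (pt A a 1)"
  obtains A' a' where "A' \<noteq> {}" "\<And>b. h (pt A a b) = pt A' a' b"
proof
  show "{i. h (pt A a 0) i \<noteq> h (pt A a 1) i} \<noteq> {}" using assms(2) by auto
  show "h (pt A a b) = pt {i. h (pt A a 0) i \<noteq> h (pt A a 1) i} (h (pt A a 0)) b" for b
  proof
    fix i
    consider j where "\<forall>x. h x i = x j" | c where "\<forall>x. h x i = c"
      using assms(1) unfolding subst_map_def by blast
    then show "h (pt A a b) i = pt {i. h (pt A a 0) i \<noteq> h (pt A a 1) i} (h (pt A a 0)) b i"
      by cases (auto simp: pt_def)
  qed
qed

section \<open>The partite construction\<close>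

text \<open>The even coordinates hold the word of the Hales--Jewett set below a point; the fibres of
  \<open>pr\<close> are the parts of the partite system.\<close>

definition pr :: "(nat \<Rightarrow> nat) \<Rightarrow> nat \<Rightarrow> nat" where
  "pr x = x \<circ> (\<lambda>i. 2 * i)"

lemma pr_join [simp]: "pr (join x y) = x"
  by (auto simp: pr_def join_def)

text \<open>
  The last condition lets every nonempty fibre serve as an alphabet of the induction hypothesis,
  which needs at least 3 letters.
\<close>
definition picture :: "nat \<Rightarrow> nat \<Rightarrow> (nat \<Rightarrow> nat) set \<Rightarrow> bool" where
  "picture q g P \<longleftrightarrow> finite P \<and> P \<subseteq> words q \<and> sparse q g P \<and>
     (\<forall>M\<subseteq>P. qline q M \<longrightarrow> inj_on pr M) \<and> (\<forall>x\<in>P. 3 \<le> card {y \<in> P. pr y = pr x})"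

text \<open>Every line of \<open>K\<close> is lifted in three disjoint copies, so that nonempty
  fibres have at least 3 points. Each quasi-line is one of these lifts, which reduces sparseness to
  counting disjoint sets.\<close>

lemma initial_picture:
  assumes "3 \<le> q" "finite K" "K \<subseteq> words q"
  obtains P where "picture q g P"
    "\<And>A a. A \<noteq> {} \<Longrightarrow> (\<And>b. b < q \<Longrightarrow> pt A a b \<in> K) \<Longrightarrow>
      \<exists>A' a'. \<forall>b<q. pt A' a' b \<in> P \<and> pr (pt A' a' b) = pt A a b"
proof -
  define E where "E = {L. L \<subseteq> K \<and> is_line q L} \<times> {..<3::nat}"
  have "finite {L. L \<subseteq> K \<and> is_line q L}"
    using assms(2) by (rule finite_subset[rotated, OF finite_Pow_iff[THEN iffD2]]) auto
  then have "finite E" unfolding E_def by simp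
  then obtain f :: "(nat \<Rightarrow> nat) set \<times> nat \<Rightarrow> nat" where f: "inj_on f E"
    using finite_imp_inj_to_nat_seg by meson
  \<comment> \<open>The odd coordinates identify a lift by the indicator of its number
    \<open>n\<close>.\<close>
  define lift where "lift = (\<lambda>n x. join x (\<lambda>m :: nat. if m = n then 1 else 0))"
  have pr_lift [simp]: "pr (lift n x) = x" for n x by (simp add: lift_def)
  have mark: "lift n x (Suc (2 * m)) = (if m = n then 1 else 0)" for n x m
    by (simp add: lift_def join_def)
  have inj_lift: "inj_on (lift n) M" for n M by (rule inj_on_inverseI[of _ pr]) simp
  define P where "P = (\<Union>e\<in>E. lift (f e) ` fst e)"
  have PE: "\<exists>e u. e \<in> E \<and> u \<in> fst e \<and> x = lift (f e) u" if "x \<in> P" for x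
    using that unfolding P_def by blast
  have PI: "lift (f e) u \<in> P" if "e \<in> E" "u \<in> fst e" for e u
    using that unfolding P_def by blast
  have line_fst: "is_line q (fst e)" "fst e \<subseteq> K" if "e \<in> E" for e
    using that unfolding E_def by auto
  \<comment> \<open>A marker coordinate takes only the letters 0 and 1, so on three or more points
    it cannot be injective and is constant; hence all points of \<open>M\<close> bear the same
    mark.\<close>
  have edges: "\<exists>e\<in>E. M = lift (f e) ` fst e" if M: "M \<subseteq> P" "qline q M" for M
  proof -
    have card: "card M = q" using M(2) unfolding qline_def by blast
    then obtain x where x: "x \<in> M" using assms(1) card_ge_3_third[of M undefined undefined] by metis
    obtain e u where e: "e \<in> E" "u \<in> fst e" "x = lift (f e) u" using PE M x by blast
    have "M \<subseteq> lift (f e) ` fst e"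
    proof
      fix y assume y: "y \<in> M"
      obtain e' u' where e': "e' \<in> E" "u' \<in> fst e'" "y = lift (f e') u'" using PE M y by blast
      have "e' = e"
      proof (rule ccontr)
        assume "e' \<noteq> e"
        then have ne: "f e' \<noteq> f e" using f e e' by (auto simp: inj_on_def)
        obtain z where z: "z \<in> M" "z \<noteq> x" "z \<noteq> y"
          using card_ge_3_third[of M x y] card assms(1) by metis
        obtain e'' u'' where "z = lift (f e'') u''" using PE M z by blast
        then have "z (Suc (2 * f e)) = (if f e = f e'' then 1 else 0)" by (simp add: mark)
        moreover have xy: "x (Suc (2 * f e)) = 1" "y (Suc (2 * f e)) = 0"
          using ne by (simp_all add: e(3) e'(3) mark)
        ultimately have "z (Suc (2 * f e)) = x (Suc (2 * f e)) \<or> z (Suc (2 * f e)) = y (Suc (2 * f e))"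
          by simp
        then have "x (Suc (2 * f e)) = y (Suc (2 * f e))"
        proof
          assume "z (Suc (2 * f e)) = x (Suc (2 * f e))"
          from qline_const_at[OF M(2) z(1) x z(2) this y] this show ?thesis by simp
        next
          assume "z (Suc (2 * f e)) = y (Suc (2 * f e))"
          from qline_const_at[OF M(2) z(1) y z(3) this x] this show ?thesis by simp
        qed
        then show False using xy by simp
      qed
      then show "y \<in> lift (f e) ` fst e" using e' by blast
    qed
    moreover have "card (lift (f e) ` fst e) = q"
      using card_image[OF inj_lift] qline_line[OF line_fst(1)[OF e(1)]]
      unfolding qline_def by metis
    moreover have "finite (lift (f e) ` fst e)"
      using line_fst(2)[OF e(1)] assms(2) by (auto intro: finite_subset)
    ultimately have "M = lift (f e) ` fst e" using card by (intro card_subset_eq) auto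
    then show ?thesis using e by blast
  qed
  have "picture q g P"
    unfolding picture_def
  proof (intro conjI ballI allI impI)
    show "finite P"
      unfolding P_def
    proof (rule finite_UN_I[OF \<open>finite E\<close>])
      show "finite (lift (f e) ` fst e)" if "e \<in> E" for e
        using line_fst(2)[OF that] assms(2) by (intro finite_imageI) (rule finite_subset)
    qed
    show "P \<subseteq> words q"
    proof
      fix x assume "x \<in> P"
      then obtain e u where "e \<in> E" "u \<in> fst e" "x = lift (f e) u" using PE by blast
      then have "u \<in> words q" "x = lift (f e) u" using line_fst(2) assms(3) by blast+
      then show "x \<in> words q" using assms(1) by (simp add: words_def lift_def join_def)
    qed
    show "inj_on pr M" if M: "M \<subseteq> P" "qline q M" for M
    proof -
      obtain e where "M = lift (f e) ` fst e" using edges[OF M] by blast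
      then show ?thesis unfolding inj_on_def by (metis imageE pr_lift)
    qed
    show "3 \<le> card {y \<in> P. pr y = pr x}" if x: "x \<in> P" for x
    proof -
      obtain e u where e: "e \<in> E" "u \<in> fst e" "x = lift (f e) u" using PE x by blast
      have E3: "(fst e, d) \<in> E" if "d < 3" for d using e that unfolding E_def by auto
      have "inj_on (\<lambda>d. lift (f (fst e, d)) u) {..<3}"
      proof (rule inj_onI)
        fix d d' assume d: "d \<in> {..<3}" "d' \<in> {..<3}"
          "lift (f (fst e, d)) u = lift (f (fst e, d')) u"
        have "lift (f (fst e, d')) u (Suc (2 * f (fst e, d))) = 1"
          unfolding d(3)[symmetric] mark by simp
        then have "f (fst e, d) = f (fst e, d')" unfolding mark by (auto split: if_splits)
        then show "d = d'" using f E3 d(1,2) unfolding inj_on_def by (metis lessThan_iff prod.inject)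
      qed
      then have "card ((\<lambda>d. lift (f (fst e, d)) u) ` {..<3}) = 3" using card_image by fastforce
      moreover have "(\<lambda>d. lift (f (fst e, d)) u) ` {..<3} \<subseteq> {y \<in> P. pr y = pr x}"
        using PI[OF E3] e by auto
      then have "card ((\<lambda>d. lift (f (fst e, d)) u) ` {..<3}) \<le> card {y \<in> P. pr y = pr x}"
        using \<open>finite P\<close> by (intro card_mono) auto
      ultimately show ?thesis by simp
    qed
    show "sparse q g P"
      unfolding sparse_def
    proof (intro allI impI, elim conjE)
      fix \<L> assume \<L>: "finite \<L>" "\<L> \<noteq> {}" "\<forall>L\<in>\<L>. L \<subseteq> P \<and> qline q L"
      have "card (\<Union>\<L>) = sum card \<L>"
      proof (rule card_Union_disjoint)
        show "finite L" if "L \<in> \<L>" for L using that \<L>(3) \<open>finite P\<close> by (auto intro: finite_subset)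
        show "pairwise disjnt \<L>"
          unfolding pairwise_def
        proof (intro ballI impI)
          fix L L' assume L: "L \<in> \<L>" "L' \<in> \<L>" "L \<noteq> L'"
          obtain e where e: "e \<in> E" "L = lift (f e) ` fst e" using edges \<L>(3) L by meson
          obtain e' where e': "e' \<in> E" "L' = lift (f e') ` fst e'" using edges \<L>(3) L by meson
          have "f e \<noteq> f e'" using L(3) e e' f by (auto simp: inj_on_def)
          have False if "x \<in> L" "x \<in> L'" for x
          proof -
            have "x (Suc (2 * f e)) = 1" using that e mark by auto
            moreover have "x (Suc (2 * f e)) = 0" using that e' mark \<open>f e \<noteq> f e'\<close> by auto
            ultimately show False by simp
          qed
          then show "disjnt L L'" unfolding disjnt_def by blast
        qed
      qed
      also have "\<dots> = q * card \<L>" using \<L>(3) by (simp add: qline_def)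
      finally have "card (\<Union>\<L>) = (q - 1) * card \<L> + card \<L>"
        using assms(1) by (cases q) auto
      moreover have "card \<L> > 0" using \<L> by (simp add: card_gt_0_iff)
      ultimately show "(q - 1) * card \<L> + 1 \<le> card (\<Union>\<L>)" by simp
    qed
  qed
  moreover have "\<exists>A' a'. \<forall>b<q. pt A' a' b \<in> P \<and> pr (pt A' a' b) = pt A a b"
    if A: "A \<noteq> {}" "\<And>b. b < q \<Longrightarrow> pt A a b \<in> K" for A a
  proof -
    let ?e = "(pt A a ` {..<q}, 0)"
    have "?e \<in> E" using A unfolding E_def is_line_def by auto
    then have "lift (f ?e) (pt A a b) \<in> P" if "b < q" for b using PI that by auto
    moreover obtain A' a' where "\<And>b. lift (f ?e) (pt A a b) = pt A' a' b"
      using that unfolding lift_def join_pt(2) by blast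
    ultimately show ?thesis by (metis pr_lift)
  qed
  ultimately show thesis using that by blast
qed

section \<open>Coding of words and amalgamation along one fibre\<close>

definition sub :: "nat \<Rightarrow> (nat \<Rightarrow> nat) \<Rightarrow> nat \<Rightarrow> nat" where
  "sub j x = x \<circ> (\<lambda>l. Suc (4 * prod_encode (j, l)))"

text \<open>Pairing stores two sequences of words in one word. In the amalgam, \<open>sub j\<close>
  holds the point of \<open>P\<close> put at position \<open>j\<close> of a line of
  \<open>Y\<close>, and \<open>blk m\<close> is a tag that tells the copies of \<open>P\<close>
  apart.\<close>

definition blk :: "nat \<Rightarrow> (nat \<Rightarrow> nat) \<Rightarrow> nat \<Rightarrow> nat" where
  "blk m x = x \<circ> (\<lambda>l. 4 * prod_encode (m, l) + 3)"

text \<open>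
  The indices \<open>2 l\<close>, \<open>4 n + 1\<close> and \<open>4 n + 3\<close> carry the projection, the letters of the sub-words and
  the letters of the blocks, so a word is determined by these three parts.
\<close>
definition assemble ::
    "(nat \<Rightarrow> nat) \<Rightarrow> (nat \<Rightarrow> nat \<Rightarrow> nat) \<Rightarrow> (nat \<Rightarrow> nat \<Rightarrow> nat) \<Rightarrow> nat \<Rightarrow> nat" where
  "assemble u y z = join u (join (\<lambda>i. case prod_decode i of (j, l) \<Rightarrow> y j l)
      (\<lambda>i. case prod_decode i of (m, l) \<Rightarrow> z m l))"

lemma assemble_simps [simp]:
  "pr (assemble u y z) = u" "sub j (assemble u y z) = y j" "blk m (assemble u y z) = z m"
proof -
  show "pr (assemble u y z) = u" by (simp add: assemble_def)
  have "Suc (4 * n) div 2 = 2 * n" "(4 * n + 3) div 2 = 2 * n + 1" for n :: nat by simp_all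
  then show "sub j (assemble u y z) = y j" "blk m (assemble u y z) = z m"
    by (simp_all add: assemble_def sub_def blk_def join_def fun_eq_iff)
qed

lemma word_coordinate:
  fixes i :: nat
  obtains l where "\<And>x :: nat \<Rightarrow> nat. x i = pr x l" | j l where "\<And>x. x i = sub j x l"
    | m l where "\<And>x. x i = blk m x l"
proof -
  obtain j l where n: "i div 4 = prod_encode (j, l)"
    by (metis prod_decode_inverse surj_pair)
  have "i = 2 * (i div 2) \<or> i = Suc (4 * (i div 4)) \<or> i = 4 * (i div 4) + 3" by presburger
  then consider "i = 2 * (i div 2)" | "i = Suc (4 * (i div 4))" | "i = 4 * (i div 4) + 3" by blast
  then show thesis
  proof cases
    case 1
    then show ?thesis by (intro that(1)[of "i div 2"]) (simp add: pr_def)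
  next
    case 2
    then show ?thesis using n by (intro that(2)[of j l]) (simp add: sub_def)
  next
    case 3
    then show ?thesis using n by (intro that(3)[of j l]) (simp add: blk_def)
  qed
qed

lemma word_eqI:
  assumes "pr x = pr y" "\<And>j. sub j x = sub j y" "\<And>m. blk m x = blk m y"
  shows "x = y"
proof
  fix i
  show "x i = y i"
  proof (rule word_coordinate[of i])
    fix l assume *: "\<And>x :: nat \<Rightarrow> nat. x i = pr x l"
    show ?thesis using *[of x] *[of y] assms by simp
  next
    fix j l assume *: "\<And>x. x i = sub j x l"
    show ?thesis using *[of x] *[of y] assms by simp
  next
    fix m l assume *: "\<And>x. x i = blk m x l"
    show ?thesis using *[of x] *[of y] assms by simp
  qed
qed

lemma assemble_words:
  assumes "u \<in> words q" "\<And>j. y j \<in> words q" "\<And>m. z m \<in> words q"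
  shows "assemble u y z \<in> words q"
  using assms by (auto simp: assemble_def join_def words_def split: sum.split prod.split)

text \<open>One gluing step. \<beta> turns the fibre over \<open>v\<close> into an alphabet of size
  \<open>s\<close>, and each line of \<open>Y\<close> in \<open>E\<close> gives a copy of
  \<open>P\<close> by letting its active positions range over all of \<open>P\<close>.
  \<open>Y\<close> is sparse for \<open>g\<close> and \<open>P\<close> for \<open>Suc g\<close>, so
  that \<open>Y\<close> can come from the induction hypothesis.\<close>

locale amalgam =
  fixes q g s :: nat and P Y :: "(nat \<Rightarrow> nat) set" and v :: "nat \<Rightarrow> nat"
    and \<beta> :: "nat \<Rightarrow> nat \<Rightarrow> nat" and E :: "(nat \<Rightarrow> nat) set set"
    and A :: "(nat \<Rightarrow> nat) set \<Rightarrow> nat set" and a :: "(nat \<Rightarrow> nat) set \<Rightarrow> nat \<Rightarrow> nat"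
    and idx :: "(nat \<Rightarrow> nat) set \<Rightarrow> nat"
  assumes q: "3 \<le> q" and P: "picture q (Suc g) P" and v: "v \<in> words q"
    and \<beta>: "bij_betw \<beta> {..<s} {x \<in> P. pr x = v}" and s: "3 \<le> s"
    and Y: "finite Y" "Y \<subseteq> words s" "sparse s g Y"
    and E: "\<And>L. L \<in> E \<Longrightarrow> L \<subseteq> Y"
    and A: "\<And>L. L \<in> E \<Longrightarrow> A L \<noteq> {}" "\<And>L. L \<in> E \<Longrightarrow> L = pt (A L) (a L) ` {..<s}"
    and idx: "inj_on idx E"
begin

text \<open>
  Off the fibre over \<open>v\<close>, block \<open>idx L\<close> distinguishes the copy belonging to \<open>L\<close> from the others; on
  the fibre all blocks equal \<open>v\<close>, and the copies intersect as the lines do.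
\<close>
definition glue :: "(nat \<Rightarrow> nat) set \<Rightarrow> (nat \<Rightarrow> nat) \<Rightarrow> nat \<Rightarrow> nat" where
  "glue L x = assemble (pr x) (\<lambda>j. if j \<in> A L then x else \<beta> (a L j))
     (\<lambda>m. if m = idx L then pr x else v)"

definition Q :: "(nat \<Rightarrow> nat) set" where
  "Q = (\<Union>L\<in>E. glue L ` P)"

text \<open>Words over the fibre alphabet become points over \<open>v\<close>. By
  \<open>glue_\<beta>\<close> the copy of \<open>P\<close> for \<open>L\<close> meets the fibre over
  \<open>v\<close> exactly in the image of \<open>L\<close>.\<close>

definition \<theta> :: "(nat \<Rightarrow> nat) \<Rightarrow> nat \<Rightarrow> nat" where
  "\<theta> w = assemble v (\<lambda>j. \<beta> (w j)) (\<lambda>m. v)"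

lemma glue_simps [simp]:
  "pr (glue L x) = pr x"
  "sub j (glue L x) = (if j \<in> A L then x else \<beta> (a L j))"
  "blk m (glue L x) = (if m = idx L then pr x else v)"
  by (simp_all add: glue_def)

lemma finP: "finite P" and Pw: "P \<subseteq> words q" and spP: "sparse q (Suc g) P"
  and pr_injP: "M \<subseteq> P \<Longrightarrow> qline q M \<Longrightarrow> inj_on pr M"
  and fibP: "x \<in> P \<Longrightarrow> 3 \<le> card {y \<in> P. pr y = pr x}"
  using P unfolding picture_def by blast+

lemma finE: "finite E"
  using Y(1) E by (meson Pow_iff finite_Pow_iff finite_subset subsetI)

lemma \<beta>_in: "i < s \<Longrightarrow> \<beta> i \<in> P" "i < s \<Longrightarrow> pr (\<beta> i) = v"
  using \<beta> unfolding bij_betw_def by auto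

lemma \<beta>_surj: "x \<in> P \<Longrightarrow> pr x = v \<Longrightarrow> \<exists>i<s. x = \<beta> i"
  using \<beta> unfolding bij_betw_def by auto

lemma a_less:
  assumes "L \<in> E" "j \<notin> A L"
  shows "a L j < s"
proof -
  have "pt (A L) (a L) 0 \<in> words s"
    using A(2)[OF assms(1)] E[OF assms(1)] Y(2) s by fastforce
  then have "pt (A L) (a L) 0 j < s" unfolding words_def by blast
  then show ?thesis using assms(2) by (simp add: pt_def)
qed

lemma QE:
  assumes "x \<in> Q"
  obtains L x' where "L \<in> E" "x' \<in> P" "x = glue L x'"
  using assms unfolding Q_def by blast

lemma sub_in: "L \<in> E \<Longrightarrow> x \<in> P \<Longrightarrow> sub j (glue L x) \<in> P"
  using \<beta>_in a_less by simp

lemma sub_fibre: "L \<in> E \<Longrightarrow> x \<in> P \<Longrightarrow> pr x = v \<Longrightarrow> pr (sub j (glue L x)) = v"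
  using \<beta>_in a_less by simp

lemma inj_glue:
  assumes "L \<in> E"
  shows "inj (glue L)"
proof (rule injI)
  fix x y assume *: "glue L x = glue L y"
  obtain j where "j \<in> A L" using A(1)[OF assms] by blast
  then show "x = y" using arg_cong[OF *, of "sub j"] by simp
qed

lemma glue_\<beta>:
  assumes "L \<in> E" "b < s"
  shows "glue L (\<beta> b) = \<theta> (pt (A L) (a L) b)"
  by (rule word_eqI) (use \<beta>_in[OF assms(2)] in \<open>auto simp: \<theta>_def pt_def\<close>)

lemma inj_\<theta>: "inj_on \<theta> (words s)"
proof (rule inj_onI, rule ext)
  fix w w' j assume *: "w \<in> words s" "w' \<in> words s" "\<theta> w = \<theta> w'"
  have "\<beta> (w j) = \<beta> (w' j)" using arg_cong[OF *(3), of "sub j"] by (simp add: \<theta>_def)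
  then show "w j = w' j"
    using * \<beta> unfolding bij_betw_def inj_on_def words_def by blast
qed

lemma subst_map_glue: "subst_map (glue L)"
  unfolding subst_map_def
proof
  fix i
  show "(\<exists>j. \<forall>x. glue L x i = x j) \<or> (\<exists>c. \<forall>x. glue L x i = c)"
  proof (rule word_coordinate[of i])
    fix l assume *: "\<And>x :: nat \<Rightarrow> nat. x i = pr x l"
    have "glue L x i = x (2 * l)" for x
      unfolding *[of "glue L x"] glue_simps by (simp add: pr_def)
    then show ?thesis by blast
  next
    fix j l assume *: "\<And>x. x i = sub j x l"
    have "glue L x i = (if j \<in> A L then x l else \<beta> (a L j) l)" for x
      unfolding *[of "glue L x"] glue_simps by simp
    then show ?thesis by (cases "j \<in> A L") auto
  next
    fix m l assume *: "\<And>x. x i = blk m x l"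
    have "glue L x i = (if m = idx L then x (2 * l) else v l)" for x
      unfolding *[of "glue L x"] glue_simps by (simp add: pr_def)
    then show ?thesis by (cases "m = idx L") auto
  qed
qed

lemma tag_unique:
  assumes "L \<in> E" "L' \<in> E" "glue L x = glue L' y" "pr x \<noteq> v"
  shows "L = L'"
proof (rule ccontr)
  assume "L \<noteq> L'"
  then have "idx L \<noteq> idx L'" using idx assms unfolding inj_on_def by blast
  then show False using arg_cong[OF assms(3), of "blk (idx L)"] assms(4) by simp
qed

text \<open>For distinct tags, a third point of \<open>M\<close> has block \<open>v\<close> at
  \<open>idx L\<close> or at \<open>idx L'\<close>, as does one of the two given points. So this
  block is constant on \<open>M\<close>, although it differs from \<open>v\<close> at the other
  given point.\<close>

lemma qline_same_tag:
  assumes M: "M \<subseteq> Q" "qline q M"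
    and L: "L \<in> E" "L' \<in> E" "glue L x \<in> M" "glue L' y \<in> M" "pr x \<noteq> v" "pr y \<noteq> v"
  shows "L = L'"
proof (rule ccontr)
  assume "L \<noteq> L'"
  then have ne: "idx L \<noteq> idx L'" using idx L unfolding inj_on_def by blast
  obtain z where z: "z \<in> M" "z \<noteq> glue L x" "z \<noteq> glue L' y"
    using card_ge_3_third[of M "glue L x" "glue L' y"] M(2) q unfolding qline_def by metis
  then obtain L'' z' where z': "L'' \<in> E" "z' \<in> P" "z = glue L'' z'" using M(1) QE by blast
  note const = qline_const[OF M(2), where \<sigma> = "\<lambda>l. 4 * prod_encode (m, l) + 3"
      for m, folded blk_def]
  show False
  proof (cases "L'' = L")
    case False
    then have "idx L'' \<noteq> idx L" using idx L z' unfolding inj_on_def by blast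
    then have "blk (idx L) z = blk (idx L) (glue L' y)" using ne z' by simp
    from const[OF z(1) L(4) z(3) this L(3)] show False using z' L ne \<open>idx L'' \<noteq> idx L\<close> by simp
  next
    case True
    then have "blk (idx L') z = blk (idx L') (glue L x)" using ne z' by simp
    from const[OF z(1) L(3) z(2) this L(4)] show False using z' L ne True by simp
  qed
qed

text \<open>Otherwise the sub-words form a quasi-line of \<open>P\<close>, on which
  \<open>pr\<close> is injective, while it is constant by hypothesis.\<close>

lemma sub_dichotomy:
  assumes "M \<subseteq> Q" "qline q M" "\<And>x y. x \<in> M \<Longrightarrow> y \<in> M \<Longrightarrow> pr (sub j x) = pr (sub j y)"
    and "x \<in> M" "y \<in> M"
  shows "sub j x = sub j y"
proof (rule ccontr)
  assume ne: "sub j x \<noteq> sub j y"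
  have *: "inj_on (sub j) M" "qline q (sub j ` M)"
    using qline_reindex[OF assms(2), of "\<lambda>l. Suc (4 * prod_encode (j, l))",
        folded sub_def] ne assms(4,5) by blast+
  have "sub j ` M \<subseteq> P"
    using assms(1) sub_in unfolding Q_def by blast
  from pr_injP[OF this *(2)] show False
    using ne assms(3-5) unfolding inj_on_def by blast
qed

text \<open>If not, \<open>pr\<close> is constant on \<open>M\<close>. Over \<open>v\<close> all
  blocks are \<open>v\<close> and all sub-words lie over \<open>v\<close>; elsewhere all points lie
  in one copy by \<open>qline_same_tag\<close>, and again each sub-word has a constant projection.
  Then \<open>sub_dichotomy\<close> leaves a single point.\<close>

lemma qline_pr:
  assumes M: "M \<subseteq> Q" "qline q M"
  shows "inj_on pr M"
proof (rule ccontr)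
  assume "\<not> inj_on pr M"
  then have const: "pr x = pr y" if "x \<in> M" "y \<in> M" for x y
    using qline_reindex[OF M(2), of "\<lambda>i. 2 * i", folded pr_def] that by blast
  obtain x where x: "x \<in> M"
    using card_ge_3_third[of M] M(2) q unfolding qline_def by metis
  obtain y where y: "y \<in> M" "y \<noteq> x"
    using card_ge_3_third[of M x x] M(2) q unfolding qline_def by metis
  obtain L x' where L: "L \<in> E" "x' \<in> P" "x = glue L x'" using x M(1) QE by blast
  have "blk m x = blk m y \<and> sub j x = sub j y" for m j
  proof (cases "pr x = v")
    case True
    have *: "blk m z = v \<and> pr (sub j z) = v" if zM: "z \<in> M" for z
    proof -
      obtain L z' where "L \<in> E" "z' \<in> P" "z = glue L z'" using zM M(1) QE by blast
      moreover have "pr z = v" using const[OF zM x] True by simp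
      ultimately show ?thesis using sub_fibre by simp
    qed
    have "sub j x = sub j y"
      by (rule sub_dichotomy[OF M]) (use * x y in auto)
    then show ?thesis using * x y by simp
  next
    case False
    have *: "\<exists>z'. z' \<in> P \<and> z = glue L z' \<and> pr z' = pr x" if zM: "z \<in> M" for z
    proof -
      obtain L' z' where z': "L' \<in> E" "z' \<in> P" "z = glue L' z'" using zM M(1) QE by blast
      moreover have "pr z = pr x" using const[OF zM x] .
      moreover have "L = L'"
        using qline_same_tag[OF M L(1) z'(1), of x' z'] L z' x zM False \<open>pr z = pr x\<close> by simp
      ultimately show ?thesis by auto
    qed
    have "sub j x = sub j y"
    proof (rule sub_dichotomy[OF M _ x y(1)])
      fix z w assume "z \<in> M" "w \<in> M"
      then obtain z' w' where "z = glue L z'" "pr z' = pr x" "w = glue L w'" "pr w' = pr x"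
        using * by blast
      then show "pr (sub j z) = pr (sub j w)" by simp
    qed
    moreover have "blk m x = blk m y" using *[OF x] *[OF y(1)] by auto
    ultimately show ?thesis by blast
  qed
  then have "x = y" by (intro word_eqI[OF const[OF x y(1)]]) simp_all
  then show False using y by simp
qed

lemma finQ: "finite Q"
  unfolding Q_def using finE finP by blast

lemma Q_words: "Q \<subseteq> words q"
proof
  fix x assume "x \<in> Q"
  then obtain L x' where x: "L \<in> E" "x' \<in> P" "x = glue L x'" by (rule QE)
  have pw: "pr w \<in> words q" if "w \<in> words q" for w
    using that by (simp add: words_def pr_def)
  show "x \<in> words q"
    unfolding x(3) glue_def
    using x(1,2) pw Pw v \<beta>_in a_less by (intro assemble_words) (auto simp: subset_iff)
qed

text \<open>All points off the fibre over \<open>v\<close> lie in one copy by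
  \<open>qline_same_tag\<close>, and at most one point \<open>y\<close> lies on it because
  \<open>pr\<close> is injective. What the other points satisfy, constant sub-words at inactive
  positions and equal ones at active positions, extends to \<open>y\<close>.\<close>

lemma qline_in_copy:
  assumes M: "M \<subseteq> Q" "qline q M"
  obtains L where "L \<in> E" "M \<subseteq> glue L ` P"
proof -
  note inj = qline_pr[OF M]
  have card: "card M = q" using M(2) unfolding qline_def by blast
  have Mw: "M \<subseteq> words q" using M(1) Q_words by blast
  have third: "\<exists>z\<in>M. z \<noteq> x \<and> z \<noteq> y" for x y
    using card_ge_3_third[of M x y] card q by metis
  have "\<exists>x\<in>M. pr x \<noteq> v"
    using third inj unfolding inj_on_def by metis
  then obtain x where x: "x \<in> M" "pr x \<noteq> v" by blast
  obtain L x' where L: "L \<in> E" "x' \<in> P" "x = glue L x'" using x M(1) QE by blast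
  have off: "\<exists>y'\<in>P. y = glue L y'" if y: "y \<in> M" "pr y \<noteq> v" for y
  proof -
    obtain L' y' where y': "L' \<in> E" "y' \<in> P" "y = glue L' y'" using y M(1) QE by blast
    then have "L = L'"
      using qline_same_tag[OF M L(1) y'(1), of x' y'] L x y by simp
    then show ?thesis using y' by blast
  qed
  have "y \<in> glue L ` P" if y: "y \<in> M" "pr y = v" for y
  proof -
    have off': "\<exists>z'\<in>P. z = glue L z'" if "z \<in> M" "z \<noteq> y" for z
      using off that inj y unfolding inj_on_def by metis
    obtain L0 y' where y': "L0 \<in> E" "y' \<in> P" "y = glue L0 y'" using y M(1) QE by blast
    obtain z where z: "z \<in> M" "z \<noteq> y" "z \<noteq> x" using third by blast
    obtain z' where z': "z' \<in> P" "z = glue L z'" using off' z by blast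
    have "x \<noteq> y" using x y by auto
    have out: "sub j y = \<beta> (a L j)" if "j \<notin> A L" for j
    proof -
      have "sub j x = sub j z" using L z' that by simp
      then have "sub j y = sub j x"
        using qline_const[OF M(2) x(1) z(1) z(3)[symmetric], where \<sigma> = "\<lambda>l. Suc (4 * prod_encode (j, l))",
          folded sub_def] y(1) by blast
      then show ?thesis using L that by simp
    qed
    have ins: "sub j y = sub j' y" if "j \<in> A L" "j' \<in> A L" for j j'
    proof
      fix l
      show "sub j y l = sub j' y l"
        unfolding sub_def comp_def
      proof (rule qline_copy_coordinate[OF M(2) q Mw y(1)])
        fix w assume "w \<in> M" "w \<noteq> y"
        then obtain w' where "w = glue L w'" using off' by blast
        then have "sub j w = sub j' w" using that by simp
        then show "w (Suc (4 * prod_encode (j, l))) =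
            w (Suc (4 * prod_encode (j', l)))"
          unfolding sub_def by (metis comp_apply)
      qed
    qed
    obtain j0 where j0: "j0 \<in> A L" using A(1)[OF L(1)] by blast
    have "y = glue L (sub j0 y)"
    proof (rule word_eqI)
      have prv: "pr (sub j0 y) = v" using sub_fibre[OF y'(1,2), of j0] y y' by simp
      then show "pr y = pr (glue L (sub j0 y))" using y by simp
      show "sub j y = sub j (glue L (sub j0 y))" for j
        using out[of j] ins[OF _ j0, of j] by (cases "j \<in> A L") simp_all
      show "blk m y = blk m (glue L (sub j0 y))" for m
        using prv y y' by simp
    qed
    moreover have "sub j0 y \<in> P" using sub_in y' by blast
    ultimately show ?thesis by blast
  qed
  then have "M \<subseteq> glue L ` P" using off by blast
  then show thesis using that L(1) by blast
qed

text \<open>An active sub-word of \<open>glue L x\<close> is \<open>x\<close> itself, so no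
  coordinate of \<open>x\<close> is lost.\<close>

lemma qline_pullback:
  assumes "L \<in> E" "M \<subseteq> glue L ` P" "qline q M"
  shows "qline q {x \<in> P. glue L x \<in> M}" "glue L ` {x \<in> P. glue L x \<in> M} = M"
proof -
  show img: "glue L ` {x \<in> P. glue L x \<in> M} = M" using assms(2) by auto
  obtain j where j: "j \<in> A L" using A(1)[OF assms(1)] by blast
  show "qline q {x \<in> P. glue L x \<in> M}"
  proof (rule qline_preimage)
    show "qline q (glue L ` {x \<in> P. glue L x \<in> M})" using img assms(3) by simp
    show "inj_on (glue L) {x \<in> P. glue L x \<in> M}"
      using inj_glue[OF assms(1)] by (rule inj_on_subset) simp
    fix i
    have "glue L x (Suc (4 * prod_encode (j, i))) = x i" for x
    proof -
      have "sub j (glue L x) i = x i" using j by simp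
      then show ?thesis by (simp add: sub_def)
    qed
    then show "\<exists>j. \<forall>x\<in>{x \<in> P. glue L x \<in> M}. glue L x j = x i" by blast
  qed
qed

text \<open>Quasi-lines are grouped by their copy. Within one copy they pull back to
  \<open>P\<close>, which is sparse; different copies overlap only over \<open>v\<close>, where the
  sparseness of \<open>Y\<close> controls them. \<open>card_Union_amalgam\<close> combines both
  bounds.\<close>

lemma sparse_Q: "sparse q (Suc g) Q"
  unfolding sparse_def
proof (intro allI impI, elim conjE)
  fix \<L> assume \<L>: "finite \<L>" "\<L> \<noteq> {}" "card \<L> \<le> Suc g" "\<forall>L\<in>\<L>. L \<subseteq> Q \<and> qline q L"
  have "\<forall>M\<in>\<L>. \<exists>L. L \<in> E \<and> M \<subseteq> glue L ` P"
    using \<L>(4) qline_in_copy by metis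
  then obtain \<tau> where \<tau>: "\<And>M. M \<in> \<L> \<Longrightarrow> \<tau> M \<in> E" "\<And>M. M \<in> \<L> \<Longrightarrow> M \<subseteq> glue (\<tau> M) ` P"
    by metis
  define R where "R = \<tau> ` \<L>"
  define F where "F = (\<lambda>e. {M \<in> \<L>. \<tau> M = e})"
  define m where "m = (\<lambda>e. card (F e))"
  define U where "U = (\<lambda>e. \<Union>(F e))"
  define N where "N = {x :: nat \<Rightarrow> nat. pr x = v}"
  have RE: "R \<subseteq> E" using \<tau>(1) by (auto simp: R_def)
  have finF: "finite (F e)" for e using \<L>(1) by (simp add: F_def)
  have UP: "U e \<subseteq> glue e ` P" for e using \<tau>(2) by (auto simp: U_def F_def)
  have sum_m: "(\<Sum>e\<in>R. m e) = card \<L>"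
    using sum.group[of \<L> R \<tau> "\<lambda>_. 1 :: nat"] \<L>(1) by (simp add: R_def m_def F_def)
  have union: "(\<Union>e\<in>R. U e) = \<Union>\<L>" by (auto simp: R_def U_def F_def)
  have "(q - 1) * (\<Sum>e\<in>R. m e) + 1 \<le> card (\<Union>e\<in>R. U e)"
  proof (rule card_Union_amalgam[where W = "\<lambda>e. \<theta> ` e" and N = N and s = s and g = g])
    show "finite R" "R \<noteq> {}" using \<L>(1,2) by (auto simp: R_def)
    show "finite (U e)" for e using UP finP by (meson finite_imageI finite_subset)
    show "finite (\<theta> ` e)" if "e \<in> R" for e
      using RE E that Y(1) by (meson finite_imageI finite_subset subsetD)
    show "U e \<inter> U e' \<subseteq> N" if e: "e \<in> R" "e' \<in> R" "e \<noteq> e'" for e e'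
    proof
      fix x assume "x \<in> U e \<inter> U e'"
      then obtain y y' where "x = glue e y" "x = glue e' y'" using UP by blast
      then show "x \<in> N" using tag_unique[of e e' y y'] e RE unfolding N_def by auto
    qed
    show "U e \<inter> N \<subseteq> \<theta> ` e" if e: "e \<in> R" for e
    proof
      fix x assume "x \<in> U e \<inter> N"
      then have "x \<in> glue e ` P" "pr x = v" using UP by (auto simp: N_def)
      then obtain y where y: "x = glue e y" "y \<in> P" by blast
      then have "pr y = v" using \<open>pr x = v\<close> by simp
      then obtain b where "b < s" "y = \<beta> b" using \<beta>_surj y(2) by blast
      moreover have "e \<in> E" using e RE by blast
      ultimately show "x \<in> \<theta> ` e" using y(1) glue_\<beta> A(2)[of e] by auto
    qed
    have card_\<theta>: "card (\<theta> ` B) = card B" if "B \<subseteq> Y" for B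
      using inj_\<theta> that Y(2) by (intro card_image) (auto intro: inj_on_subset)
    have line: "qline s e" "e \<subseteq> Y" if "e \<in> R" for e
    proof -
      have "e \<in> E" using RE that by blast
      then show "qline s e" "e \<subseteq> Y"
        using A[of e] E[of e] qline_line[of s e] unfolding is_line_def by blast+
    qed
    show "card (\<theta> ` e) = s" if "e \<in> R" for e
      using card_\<theta>[OF line(2)[OF that]] line(1)[OF that] unfolding qline_def by simp
    show "1 \<le> s" using s by simp
    show "(s - 1) * card R' + 1 \<le> card (\<Union>e\<in>R'. \<theta> ` e)"
      if R': "R' \<subseteq> R" "R' \<noteq> {}" "card R' \<le> g" for R'
    proof -
      have "finite R'" using R'(1) \<L>(1) by (auto simp: R_def intro: finite_subset)
      then have "(s - 1) * card R' + 1 \<le> card (\<Union>R')"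
        using sparseD[OF Y(3) _ R'(2,3)] line R'(1) by blast
      also have "\<dots> = card (\<theta> ` \<Union>R')" using line R'(1) by (intro card_\<theta>[symmetric]) blast
      finally show ?thesis by (simp add: image_Union)
    qed
    \<comment> \<open>By \<open>qline_pr\<close> each quasi-line has at most one point over
      \<open>v\<close>.\<close>
    show "card (U e \<inter> N) \<le> m e" for e
    proof -
      have "card (M \<inter> N) \<le> 1" if "M \<in> F e" for M
      proof -
        have "inj_on pr M" using \<L>(4) qline_pr that by (auto simp: F_def)
        then have "\<forall>x\<in>M \<inter> N. \<forall>y\<in>M \<inter> N. x = y" by (auto simp: inj_on_def N_def)
        moreover have "finite (M \<inter> N)"
          using that \<L>(4) finQ by (auto simp: F_def intro: finite_subset)
        ultimately show ?thesis by (simp add: card_le_Suc0_iff_eq)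
      qed
      then have "(\<Sum>M\<in>F e. card (M \<inter> N)) \<le> card (F e)"
        using sum_mono[of "F e" "\<lambda>M. card (M \<inter> N)" "\<lambda>_. 1"] by simp
      moreover have "card (\<Union>M\<in>F e. M \<inter> N) \<le> (\<Sum>M\<in>F e. card (M \<inter> N))"
        using finF by (rule card_UN_le)
      moreover have "U e \<inter> N = (\<Union>M\<in>F e. M \<inter> N)" by (auto simp: U_def)
      ultimately show ?thesis by (simp add: m_def)
    qed
    show "(\<Sum>e\<in>R. m e) \<le> Suc g" using sum_m \<L>(3) by simp
    show "(q - 1) * m e + 1 \<le> card (U e)" if "e \<in> R" for e
    proof -
      define B where "B = (\<lambda>M. {x \<in> P. glue e x \<in> M})"
      have "e \<in> E" using RE that by blast
      have M: "qline q (B M)" "glue e ` B M = M" if "M \<in> F e" for M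
      proof -
        have "M \<subseteq> glue e ` P" "qline q M" using that \<tau>(2) \<L>(4) by (auto simp: F_def)
        from qline_pullback[OF \<open>e \<in> E\<close> this] show "qline q (B M)" "glue e ` B M = M"
          by (simp_all add: B_def)
      qed
      have "inj_on B (F e)" using M(2) by (metis inj_onI)
      then have card: "card (B ` F e) = m e" unfolding m_def by (rule card_image)
      have "m e \<le> Suc g"
        using \<L>(1,3) card_mono[of \<L> "F e"] by (auto simp: m_def F_def)
      moreover have "F e \<noteq> {}" using that by (auto simp: R_def F_def)
      ultimately have "(q - 1) * card (B ` F e) + 1 \<le> card (\<Union>(B ` F e))"
        using card finF M(1) by (intro sparseD[OF spP]) (auto simp: B_def)
      also have "\<dots> = card (glue e ` \<Union>(B ` F e))"
        using inj_glue[OF \<open>e \<in> E\<close>] by (intro card_image[symmetric]) (auto intro: inj_on_subset)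
      also have "glue e ` \<Union>(B ` F e) = U e"
        using M(2) by (simp add: U_def image_UN)
      finally show ?thesis using card by simp
    qed
  qed
  then show "(q - 1) * card \<L> + 1 \<le> card (\<Union>\<L>)" unfolding sum_m union .
qed

lemma picture_Q: "picture q (Suc g) Q"
  unfolding picture_def
proof (intro conjI ballI allI impI)
  fix x assume "x \<in> Q"
  then obtain L x' where x: "L \<in> E" "x' \<in> P" "x = glue L x'" by (rule QE)
  have "3 \<le> card {y \<in> P. pr y = pr x'}" using fibP x(2) .
  also have "\<dots> = card (glue L ` {y \<in> P. pr y = pr x'})"
    using inj_glue[OF x(1)] by (intro card_image[symmetric]) (auto intro: inj_on_subset)
  also have "\<dots> \<le> card {y \<in> Q. pr y = pr x}"
  proof (rule card_mono)
    show "finite {y \<in> Q. pr y = pr x}" using finQ by simp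
  qed (use x in \<open>auto simp: Q_def\<close>)
  finally show "3 \<le> card {y \<in> Q. pr y = pr x}" .
qed (use finQ Q_words sparse_Q qline_pr in auto)

end

section \<open>Iteration over all fibres and the induction on \<open>g\<close>\<close>

definition sparse_HJ :: "nat \<Rightarrow> bool" where
  "sparse_HJ g \<longleftrightarrow> (\<forall>q\<ge>3. \<forall>k\<ge>1. \<exists>X. finite X \<and> X \<subseteq> words q \<and> sparse q g X \<and> line_ramsey q k X)"

text \<open>The maps \<open>h\<close> compose and preserve \<open>pr\<close>, so fibres can be made
  monochromatic one after the other. As substitutions they also transport lines.\<close>

definition fibre_arrow ::
    "nat \<Rightarrow> (nat \<Rightarrow> nat) set \<Rightarrow> (nat \<Rightarrow> nat) set \<Rightarrow> (nat \<Rightarrow> nat) set \<Rightarrow> bool" where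
  "fibre_arrow k V P Q \<longleftrightarrow> (\<forall>c :: (nat \<Rightarrow> nat) \<Rightarrow> nat. (\<forall>x\<in>Q. c x < k) \<longrightarrow>
     (\<exists>h. subst_map h \<and> (\<forall>x. pr (h x) = pr x) \<and> (\<forall>x\<in>P. h x \<in> Q) \<and>
        (\<forall>v\<in>V. \<exists>j. \<forall>x\<in>P. pr x = v \<longrightarrow> c (h x) = j)))"

lemma fibre_arrowE:
  fixes c :: "(nat \<Rightarrow> nat) \<Rightarrow> nat"
  assumes "fibre_arrow k V P Q" "\<And>x. x \<in> Q \<Longrightarrow> c x < k"
  obtains h j where "subst_map h" "\<And>x. pr (h x) = pr x" "\<And>x. x \<in> P \<Longrightarrow> h x \<in> Q"
    "\<And>x. x \<in> P \<Longrightarrow> pr x \<in> V \<Longrightarrow> c (h x) = j (pr x)"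
proof -
  have "\<forall>x\<in>Q. c x < k" using assms(2) by blast
  with assms(1)[unfolded fibre_arrow_def, THEN spec[of _ c]]
  have "\<exists>h. subst_map h \<and> (\<forall>x. pr (h x) = pr x) \<and> (\<forall>x\<in>P. h x \<in> Q) \<and>
        (\<forall>v\<in>V. \<exists>j. \<forall>x\<in>P. pr x = v \<longrightarrow> c (h x) = j)" by (rule mp)
  then obtain h where h: "subst_map h" "\<And>x. pr (h x) = pr x" "\<And>x. x \<in> P \<Longrightarrow> h x \<in> Q"
    "\<forall>v\<in>V. \<exists>j. \<forall>x\<in>P. pr x = v \<longrightarrow> c (h x) = j" by blast
  from bchoice[OF h(4)] obtain j where "\<forall>v\<in>V. \<forall>x\<in>P. pr x = v \<longrightarrow> c (h x) = j v" by blast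
  then show thesis using h(1-3) by (intro that[of h j]) auto
qed

lemma fibre_arrow_refl:
  assumes "\<And>x. x \<in> P \<Longrightarrow> pr x \<notin> V"
  shows "fibre_arrow k V P P"
  unfolding fibre_arrow_def
  using subst_map_id assms by (intro allI impI exI[of _ id]) auto

text \<open>The colouring is first pulled back along a copy of \<open>P'\<close> whose fibres over
  \<open>V'\<close> are monochromatic; a copy of \<open>P\<close> inside \<open>P'\<close> then
  treats \<open>V\<close> and inherits the rest, since \<open>pr\<close> is preserved.\<close>

lemma fibre_arrow_trans:
  assumes "fibre_arrow k V P P'" "fibre_arrow k V' P' P''"
  shows "fibre_arrow k (V \<union> V') P P''"
  unfolding fibre_arrow_def
proof (intro allI impI)
  fix c :: "(nat \<Rightarrow> nat) \<Rightarrow> nat"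
  assume c: "\<forall>x\<in>P''. c x < k"
  obtain h' j' where h': "subst_map h'" "\<And>x. pr (h' x) = pr x" "\<And>x. x \<in> P' \<Longrightarrow> h' x \<in> P''"
    "\<And>x. x \<in> P' \<Longrightarrow> pr x \<in> V' \<Longrightarrow> c (h' x) = j' (pr x)"
    using fibre_arrowE[OF assms(2), of c] c by metis
  obtain h j where h: "subst_map h" "\<And>x. pr (h x) = pr x" "\<And>x. x \<in> P \<Longrightarrow> h x \<in> P'"
    "\<And>x. x \<in> P \<Longrightarrow> pr x \<in> V \<Longrightarrow> c (h' (h x)) = j (pr x)"
    using fibre_arrowE[OF assms(1), of "\<lambda>x. c (h' x)"] c h'(3) by metis
  have "\<exists>i. \<forall>x\<in>P. pr x = v \<longrightarrow> c ((h' \<circ> h) x) = i" if v: "v \<in> V \<union> V'" for v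
  proof (cases "v \<in> V")
    case True
    then show ?thesis using h(4) by (intro exI[of _ "j v"]) auto
  next
    case False
    then have "v \<in> V'" using v by blast
    then show ?thesis using h'(4) h(2,3) by (intro exI[of _ "j' v"]) auto
  qed
  moreover have "\<forall>x. pr ((h' \<circ> h) x) = pr x" "\<forall>x\<in>P. (h' \<circ> h) x \<in> P''"
    using h(2,3) h'(2,3) by simp_all
  ultimately show "\<exists>h. subst_map h \<and> (\<forall>x. pr (h x) = pr x) \<and> (\<forall>x\<in>P. h x \<in> P'') \<and>
        (\<forall>v\<in>V \<union> V'. \<exists>j. \<forall>x\<in>P. pr x = v \<longrightarrow> c (h x) = j)"
    using subst_map_comp[OF h(1) h'(1)] by (intro exI[of _ "h' \<circ> h"]) blast
qed

text \<open>The fibre over \<open>v\<close> is the alphabet of a sparse Ramsey set given by the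
  induction hypothesis. A monochromatic line of that set is, through \<theta>, the fibre over
  \<open>v\<close> of the copy of \<open>P\<close> glued along it. If the fibre is empty,
  \<open>P\<close> itself works.\<close>

lemma amalgamation:
  assumes IH: "sparse_HJ g" and "3 \<le> q" "1 \<le> k" and P: "picture q (Suc g) P"
  shows "\<exists>Q. picture q (Suc g) Q \<and> fibre_arrow k {v} P Q"
proof (cases "\<exists>x\<in>P. pr x = v")
  case False
  then have "fibre_arrow k {v} P P" by (intro fibre_arrow_refl) blast
  then show ?thesis using P by blast
next
  case True
  then obtain x0 where x0: "x0 \<in> P" "pr x0 = v" by blast
  define S where "S = {x \<in> P. pr x = v}"
  have S: "finite S" "3 \<le> card S" using P x0 unfolding picture_def S_def by auto
  obtain \<beta> where \<beta>: "bij_betw \<beta> {..<card S} S"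
    using ex_bij_betw_nat_finite[OF S(1)] by (auto simp: atLeast0LessThan)
  obtain Y where Y: "finite Y" "Y \<subseteq> words (card S)" "sparse (card S) g Y" and
    ramsey: "line_ramsey (card S) k Y"
    using IH S(2) assms(3) unfolding sparse_HJ_def by blast
  define E where "E = {L. L \<subseteq> Y \<and> is_line (card S) L}"
  have "\<forall>L\<in>E. \<exists>A a. A \<noteq> {} \<and> L = pt A a ` {..<card S}"
    unfolding E_def is_line_def by blast
  then obtain A a where Aa: "\<And>L. L \<in> E \<Longrightarrow> A L \<noteq> {}" "\<And>L. L \<in> E \<Longrightarrow> L = pt (A L) (a L) ` {..<card S}"
    by metis
  have "finite E" using Y(1) unfolding E_def by simp
  then obtain idx :: "(nat \<Rightarrow> nat) set \<Rightarrow> nat" where "inj_on idx E"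
    using finite_imp_inj_to_nat_seg by meson
  moreover have "v \<in> words q"
    using x0 P unfolding picture_def words_def pr_def by auto
  ultimately interpret amalgam q g "card S" P Y v \<beta> E A a idx
    using assms P \<beta> S Y Aa by unfold_locales (auto simp: S_def E_def)
  have "fibre_arrow k {v} P Q"
    unfolding fibre_arrow_def
  proof (intro allI impI)
    fix c :: "(nat \<Rightarrow> nat) \<Rightarrow> nat"
    assume c: "\<forall>x\<in>Q. c x < k"
    \<comment> \<open>A word of \<open>Y\<close> on no line of \<open>E\<close> may have its
      \<theta>-image outside \<open>Q\<close>; the default colour 0 is below \<open>k\<close> since
      \<open>1 \<le> k\<close>.\<close>
    define c' where "c' = (\<lambda>w. if \<theta> w \<in> Q then c (\<theta> w) else 0)"
    have "mono_line (card S) c' Y"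
      using c assms(3) by (intro line_ramseyD[OF ramsey]) (auto simp: c'_def)
    then obtain B b j where B: "B \<noteq> {}" "\<And>i. i < card S \<Longrightarrow> pt B b i \<in> Y"
      "\<And>i. i < card S \<Longrightarrow> c' (pt B b i) = j"
      by (rule mono_lineE) blast
    let ?L = "pt B b ` {..<card S}"
    have L: "?L \<in> E" using B unfolding E_def is_line_def by auto
    have "\<forall>x\<in>P. glue ?L x \<in> Q" using L unfolding Q_def by blast
    moreover have "c (glue ?L x) = j" if x: "x \<in> P" "pr x = v" for x
    proof -
      obtain i where i: "i < card S" "x = \<beta> i" using \<beta>_surj[OF x] by blast
      have *: "glue ?L x = \<theta> (pt (A ?L) (a ?L) i)" using glue_\<beta>[OF L i(1)] i(2) by simp
      have "glue ?L x \<in> Q" using L x unfolding Q_def by blast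
      \<comment> \<open>The representation \<open>A ?L\<close>, \<open>a ?L\<close> fixed in the
        locale may differ from \<open>B\<close>, \<open>b\<close>; only the point sets agree, whence
        a new index \<open>i'\<close>.\<close>
      moreover have "pt (A ?L) (a ?L) i \<in> ?L"
        using Aa(2)[OF L] i(1) by blast
      then obtain i' where "i' < card S" "pt (A ?L) (a ?L) i = pt B b i'" by blast
      ultimately show ?thesis using B(3)[of i'] unfolding * c'_def by simp
    qed
    ultimately show "\<exists>h. subst_map h \<and> (\<forall>x. pr (h x) = pr x) \<and> (\<forall>x\<in>P. h x \<in> Q) \<and>
        (\<forall>v\<in>{v}. \<exists>j. \<forall>x\<in>P. pr x = v \<longrightarrow> c (h x) = j)"
      using subst_map_glue by (intro exI[of _ "glue ?L"]) auto
  qed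
  then show ?thesis using picture_Q by blast
qed

lemma amalgamation_iterate:
  assumes "sparse_HJ g" "3 \<le> q" "1 \<le> k" "finite V" "picture q (Suc g) P"
  shows "\<exists>Q. picture q (Suc g) Q \<and> fibre_arrow k V P Q"
  using assms(4,5)
proof (induction V arbitrary: P)
  case empty
  then show ?case using fibre_arrow_refl by blast
next
  case (insert v V)
  obtain P' where P': "picture q (Suc g) P'" "fibre_arrow k {v} P P'"
    using amalgamation[OF assms(1-3) insert.prems] by blast
  obtain Q where Q: "picture q (Suc g) Q" "fibre_arrow k V P' Q"
    using insert.IH[OF P'(1)] by blast
  show ?case using fibre_arrow_trans[OF P'(2) Q(2)] Q(1) by auto
qed

text \<open>Once the fibres over all of \<open>K\<close> are treated, the colour on a copy of
  \<open>P\<close> depends on \<open>pr\<close> only and thus colours \<open>K\<close>. A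
  monochromatic line of \<open>K\<close> lifts to \<open>P\<close> and is carried on to
  \<open>Q\<close>. The induction runs over all alphabets at once, since fibres of any size become
  alphabets.\<close>

theorem sparse_Hales_Jewett: "sparse_HJ g"
proof (induction g)
  case 0
  then show ?case
    unfolding sparse_HJ_def
  proof (intro allI impI)
    fix q k :: nat assume "3 \<le> q"
    then obtain X where "finite X" "X \<subseteq> words q" "line_ramsey q k X"
      using Hales_Jewett[of q k] by auto
    then show "\<exists>X. finite X \<and> X \<subseteq> words q \<and> sparse q 0 X \<and> line_ramsey q k X"
      by (intro exI[of _ X]) (auto simp: sparse_def)
  qed
next
  case (Suc g)
  show ?case
    unfolding sparse_HJ_def
  proof (intro allI impI)
    fix q k :: nat assume q: "3 \<le> q" and k: "1 \<le> k"
    obtain K where K: "finite K" "K \<subseteq> words q" "line_ramsey q k K"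
      using Hales_Jewett[of q k] q by auto
    obtain P where P: "picture q (Suc g) P" "\<And>A a. A \<noteq> {} \<Longrightarrow> (\<And>b. b < q \<Longrightarrow> pt A a b \<in> K) \<Longrightarrow>
      \<exists>A' a'. \<forall>b<q. pt A' a' b \<in> P \<and> pr (pt A' a' b) = pt A a b"
      using initial_picture[OF q K(1,2)] by blast
    obtain Q where Q: "picture q (Suc g) Q" "fibre_arrow k K P Q"
      using amalgamation_iterate[OF Suc.IH q k K(1) P(1)] by blast
    have "mono_line q c Q" if c: "\<forall>x\<in>Q. c x < k" for c :: "(nat \<Rightarrow> nat) \<Rightarrow> nat"
    proof -
      obtain h j where h: "subst_map h" "\<And>x. pr (h x) = pr x" "\<And>x. x \<in> P \<Longrightarrow> h x \<in> Q"
        "\<And>x. x \<in> P \<Longrightarrow> pr x \<in> K \<Longrightarrow> c (h x) = j (pr x)"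
        using fibre_arrowE[OF Q(2), of c] c by metis
      \<comment> \<open>Words of \<open>K\<close> with an empty fibre get 0, a legal colour since
        \<open>1 \<le> k\<close>.\<close>
      define c' where "c' = (\<lambda>v. if v \<in> pr ` P then j v else 0)"
      have "c' v < k" if v: "v \<in> K" for v
      proof (cases "v \<in> pr ` P")
        case True
        then obtain x where "x \<in> P" "pr x = v" by blast
        then have "j v = c (h x)" "h x \<in> Q" using v h(3,4) by auto
        then show ?thesis using c True by (simp add: c'_def)
      qed (use k in \<open>simp add: c'_def\<close>)
      then have "mono_line q c' K" by (rule line_ramseyD[OF K(3)])
      then obtain A a i where A: "A \<noteq> {}" "\<And>b. b < q \<Longrightarrow> pt A a b \<in> K"
        "\<And>b. b < q \<Longrightarrow> c' (pt A a b) = i"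
        by (rule mono_lineE) blast
      obtain A1 a1 where A1: "\<And>b. b < q \<Longrightarrow> pt A1 a1 b \<in> P"
        "\<And>b. b < q \<Longrightarrow> pr (pt A1 a1 b) = pt A a b"
        using P(2)[OF A(1,2)] by blast
      \<comment> \<open>\<open>pr\<close> separates the points at letters 0 and 1, hence so does
        \<open>h\<close>, and the image is a line rather than a point.\<close>
      have "pt A a 0 \<noteq> pt A a 1" using inj_pt[OF A(1)] by (metis inj_eq zero_neq_one)
      then have "h (pt A1 a1 0) \<noteq> h (pt A1 a1 1)"
        using h(2)[of "pt A1 a1 0"] h(2)[of "pt A1 a1 1"] A1(2)[of 0] A1(2)[of 1] q by auto
      with h(1) obtain A2 a2 where A2: "A2 \<noteq> {}" "\<And>b. h (pt A1 a1 b) = pt A2 a2 b"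
        by (rule subst_map_pt) blast
      show ?thesis
      proof (rule mono_lineI[OF A2(1)])
        fix b assume b: "b < q"
        show "pt A2 a2 b \<in> Q" using A1(1)[OF b] h(3) A2(2) by metis
        have "c (pt A2 a2 b) = j (pt A a b)"
          using h(4)[OF A1(1)[OF b]] A1(2)[OF b] A(2)[OF b] A2(2) by simp
        moreover have "pt A a b \<in> pr ` P" using A1[OF b] by (metis imageI)
        then have "j (pt A a b) = i" using A(3)[OF b] by (simp add: c'_def)
        ultimately show "c (pt A2 a2 b) = i" by simp
      qed
    qed
    then show "\<exists>X. finite X \<and> X \<subseteq> words q \<and> sparse q (Suc g) X \<and> line_ramsey q k X"
      using Q(1) unfolding picture_def line_ramsey_def by blast
  qed
qed

section \<open>Generic projections\<close>

text \<open>Separate polynomiality suffices to choose the generic weights one coordinate at a time.\<close>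
definition sep_poly :: "((nat \<Rightarrow> real) \<Rightarrow> real) \<Rightarrow> bool" where
  "sep_poly G \<longleftrightarrow> (\<forall>w i. \<exists>p. \<forall>t. G (w(i := t)) = poly p t)"

lemma sep_polyD: "sep_poly G \<Longrightarrow> \<exists>p. \<forall>t. G (w(i := t)) = poly p t"
  unfolding sep_poly_def by blast

lemma sep_poly_const: "sep_poly (\<lambda>w. c)"
  unfolding sep_poly_def by (intro allI exI[of _ "[:c:]"]) simp

lemma sep_poly_coordinate: "sep_poly (\<lambda>w. w j)"
  unfolding sep_poly_def
proof (intro allI)
  fix w :: "nat \<Rightarrow> real" and i
  show "\<exists>p. \<forall>t. (w(i := t)) j = poly p t"
    by (rule exI[of _ "if i = j then [:0, 1:] else [:w j:]"]) simp
qed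

lemma sep_poly_add:
  assumes "sep_poly G" "sep_poly H"
  shows "sep_poly (\<lambda>w. G w + H w)"
  unfolding sep_poly_def
proof (intro allI)
  fix w :: "nat \<Rightarrow> real" and i
  obtain p where p: "\<And>t. G (w(i := t)) = poly p t" using sep_polyD[OF assms(1)] by blast
  obtain r where r: "\<And>t. H (w(i := t)) = poly r t" using sep_polyD[OF assms(2)] by blast
  show "\<exists>p. \<forall>t. G (w(i := t)) + H (w(i := t)) = poly p t"
    using p r by (intro exI[of _ "p + r"]) simp
qed

lemma sep_poly_mult:
  assumes "sep_poly G" "sep_poly H"
  shows "sep_poly (\<lambda>w. G w * H w)"
  unfolding sep_poly_def
proof (intro allI)
  fix w :: "nat \<Rightarrow> real" and i
  obtain p where p: "\<And>t. G (w(i := t)) = poly p t" using sep_polyD[OF assms(1)] by blast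
  obtain r where r: "\<And>t. H (w(i := t)) = poly r t" using sep_polyD[OF assms(2)] by blast
  show "\<exists>p. \<forall>t. G (w(i := t)) * H (w(i := t)) = poly p t"
    using p r by (intro exI[of _ "p * r"]) simp
qed

lemma sep_poly_sum:
  assumes "\<And>a. a \<in> A \<Longrightarrow> sep_poly (G a)"
  shows "sep_poly (\<lambda>w. \<Sum>a\<in>A. G a w)"
  using assms
  by (induction A rule: infinite_finite_induct) (simp_all add: sep_poly_const sep_poly_add)

lemma sep_poly_prod:
  assumes "\<And>a. a \<in> A \<Longrightarrow> sep_poly (G a)"
  shows "sep_poly (\<lambda>w. \<Prod>a\<in>A. G a w)"
  using assms
  by (induction A rule: infinite_finite_induct) (simp_all add: sep_poly_const sep_poly_mult)

lemma sep_poly_power: "sep_poly G \<Longrightarrow> sep_poly (\<lambda>w. G w ^ n)"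
  by (induction n) (simp_all add: sep_poly_const sep_poly_mult)

lemma sep_poly_upd:
  assumes "sep_poly G"
  shows "sep_poly (\<lambda>w. G (w(i := s)))"
  unfolding sep_poly_def
proof (intro allI)
  fix w :: "nat \<Rightarrow> real" and j
  obtain p where p: "\<And>t. G ((w(i := s))(j := t)) = poly p t" using sep_polyD[OF assms] by blast
  show "\<exists>p. \<forall>t. G ((w(j := t))(i := s)) = poly p t"
  proof (cases "i = j")
    case True
    then show ?thesis by (intro exI[of _ "[:G (w(j := s)):]"]) simp
  next
    case False
    then show ?thesis using p by (intro exI[of _ p]) (metis fun_upd_twist)
  qed
qed

text \<open>The coordinates in \<open>I\<close> are fixed one by one. A weight is bad for
  \<open>G\<close> only if it is a root of a polynomial that does not vanish at
  \<open>W G i\<close>; countably many finite root sets cannot the unit interval exhaust. The last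
  hypothesis makes each \<open>G\<close> constant once \<open>I\<close> is used up.\<close>

lemma generic_positive:
  assumes "finite I" "countable \<G>"
    and "\<And>G. G \<in> \<G> \<Longrightarrow> sep_poly G" "\<And>G. G \<in> \<G> \<Longrightarrow> \<exists>w. G w \<noteq> 0"
    and "\<And>G w w'. G \<in> \<G> \<Longrightarrow> (\<And>i. i \<in> I \<Longrightarrow> w i = w' i) \<Longrightarrow> G w = G w'"
  shows "\<exists>w. (\<forall>i. w i > 0) \<and> (\<forall>G\<in>\<G>. G w \<noteq> 0)"
  using assms
proof (induction I arbitrary: \<G> rule: finite_induct)
  case empty
  then show ?case by (intro exI[of _ "\<lambda>_. 1"]) (metis empty_iff zero_less_one)
next
  case (insert i I)
  have "\<forall>G\<in>\<G>. \<exists>w. G w \<noteq> 0" using insert.prems(3) by blast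
  then obtain W where W: "\<And>G. G \<in> \<G> \<Longrightarrow> G (W G) \<noteq> 0" by metis
  define R where "R = (\<lambda>G. {t. G ((W G)(i := t)) = 0})"
  have "finite (R G)" if G: "G \<in> \<G>" for G
  proof -
    obtain p where p: "\<And>t. G ((W G)(i := t)) = poly p t"
      using sep_polyD[OF insert.prems(2)[OF G]] by blast
    have "poly p (W G i) \<noteq> 0" using W[OF G] p[of "W G i"] by simp
    then have "p \<noteq> 0" by auto
    then show ?thesis unfolding R_def p by (rule poly_roots_finite)
  qed
  then have "countable (\<Union>G\<in>\<G>. R G)"
    using insert.prems(1) by (intro countable_UN) (auto intro: countable_finite)
  moreover have "uncountable {0<..<1::real}" by (simp add: uncountable_open_interval)
  ultimately have "\<not> {0<..<1} \<subseteq> (\<Union>G\<in>\<G>. R G)" using countable_subset by blast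
  then obtain s where "s \<in> {0<..<1}" "s \<notin> (\<Union>G\<in>\<G>. R G)" by blast
  then have s: "0 < s" "\<And>G. G \<in> \<G> \<Longrightarrow> s \<notin> R G" by auto
  have "\<exists>w. (\<forall>i. w i > 0) \<and> (\<forall>G\<in>(\<lambda>G w. G (w(i := s))) ` \<G>. G w \<noteq> 0)"
  proof (rule insert.IH)
    show "countable ((\<lambda>G w. G (w(i := s))) ` \<G>)" using insert.prems(1) by simp
    show "sep_poly G" if "G \<in> (\<lambda>G w. G (w(i := s))) ` \<G>" for G
      using that insert.prems(2) sep_poly_upd by blast
    show "\<exists>w. G w \<noteq> 0" if "G \<in> (\<lambda>G w. G (w(i := s))) ` \<G>" for G
      using that s(2) by (auto simp: R_def)
    show "G w = G w'" if G: "G \<in> (\<lambda>G w. G (w(i := s))) ` \<G>" and ww: "\<And>i. i \<in> I \<Longrightarrow> w i = w' i"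
      for G w w'
    proof -
      obtain H where H: "H \<in> \<G>" "G = (\<lambda>w. H (w(i := s)))" using G by blast
      have "H (w(i := s)) = H (w'(i := s))"
        by (rule insert.prems(4)[OF H(1)]) (use ww in auto)
      then show ?thesis using H(2) by simp
    qed
  qed
  then obtain w where w: "\<And>i. w i > 0" "\<And>G. G \<in> \<G> \<Longrightarrow> G (w(i := s)) \<noteq> 0" by auto
  show ?case
  proof (intro exI conjI)
    show "\<forall>j. (w(i := s)) j > 0" using w(1) s(1) by simp
    show "\<forall>G\<in>\<G>. G (w(i := s)) \<noteq> 0" using w(2) by blast
  qed
qed

section \<open>Weighted projections and cycles\<close>

definition wsum :: "nat set \<Rightarrow> (nat \<Rightarrow> 'a::real_vector) \<Rightarrow> (nat \<Rightarrow> real) \<Rightarrow> 'a" where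
  "wsum I d w = (\<Sum>j\<in>I. w j *\<^sub>R d j)"

lemma wsum_unit:
  assumes "finite I" "j \<in> I"
  shows "wsum I d (\<lambda>i. if i = j then 1 else 0) = d j"
proof -
  have "wsum I d (\<lambda>i. if i = j then 1 else 0) = (\<Sum>i\<in>I. if i = j then d i else 0)"
    unfolding wsum_def by (rule sum.cong) auto
  also have "\<dots> = d j" using assms by simp
  finally show ?thesis .
qed

lemma wsum_cong: "(\<And>i. i \<in> I \<Longrightarrow> w i = w' i) \<Longrightarrow> wsum I d w = wsum I d w'"
  unfolding wsum_def by (rule sum.cong) auto

lemma wsum_diff: "wsum I (\<lambda>j. d j - e j) w = wsum I d w - wsum I e w"
  unfolding wsum_def by (simp add: scaleR_right_diff_distrib sum_subtractf)

text \<open>Together with \<open>wsum_diff\<close> this rewrites the weighted sum of a family of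
  vectors \<open>D\<close> as the same linear expression in the projected points.\<close>

lemma wsum_inner_scale:
  fixes d :: "nat \<Rightarrow> 'a::real_inner"
  shows "wsum I (\<lambda>j. ((d j \<bullet> v) / N) *\<^sub>R u) w = ((wsum I d w \<bullet> v) / N) *\<^sub>R u"
  unfolding wsum_def
  by (simp add: inner_sum_left scaleR_sum_left sum_divide_distrib)

lemma sep_poly_wsum: "sep_poly (\<lambda>w. wsum I d w $ i)"
  unfolding wsum_def
  by (simp add: sep_poly_sum sep_poly_mult sep_poly_coordinate sep_poly_const)

text \<open>The squared norm turns the vector condition \<open>wsum I d w \<noteq> 0\<close> into
  one on a real polynomial.\<close>

lemma sep_poly_wsum_inner:
  fixes d :: "nat \<Rightarrow> real ^ 'n"
  shows "sep_poly (\<lambda>w. wsum I d w \<bullet> wsum I d w)"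
  unfolding inner_vec_def inner_real_def
  by (intro sep_poly_sum sep_poly_mult sep_poly_wsum)

lemma sep_poly_eval_at_pair:
  fixes d e :: "nat \<Rightarrow> real ^ 'n"
  shows "sep_poly (\<lambda>w. eval_at_pair f (wsum I d w) (wsum I e w))"
proof -
  have "sep_poly (\<lambda>w. case_sum (\<lambda>i. wsum I d w $ i) (\<lambda>i. wsum I e w $ i) v)" for v :: "'n + 'n"
    by (cases v) (simp_all add: sep_poly_wsum)
  then show ?thesis
    unfolding eval_at_pair_def real_poly_eval_def
    by (intro sep_poly_sum sep_poly_mult sep_poly_const sep_poly_prod sep_poly_power)
qed

text \<open>Bounded letters on a finite set allow only finitely many coordinate functions;
  \<open>I\<close> represents them, so that a finite sum can see every coordinate.\<close>

lemma finite_coordinates: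
  assumes "finite X" "X \<subseteq> words q"
  obtains I where "finite I" "\<And>i. \<exists>j\<in>I. \<forall>x\<in>X. x i = x j"
proof -
  define r where "r = (\<lambda>i. restrict (\<lambda>x :: nat \<Rightarrow> nat. x i) X)"
  have "range r \<subseteq> X \<rightarrow>\<^sub>E {..<q}"
    using assms(2) unfolding r_def words_def by (auto simp: PiE_iff)
  moreover have "finite (X \<rightarrow>\<^sub>E {..<q})" using assms(1) by (simp add: finite_PiE)
  ultimately have "finite (range r)" by (rule finite_subset)
  from finite_subset_image[OF this, of r UNIV] obtain I where I: "finite I" "range r = r ` I"
    by blast
  have "\<exists>j\<in>I. \<forall>x\<in>X. x i = x j" for i
  proof -
    obtain j where j: "j \<in> I" "r i = r j" using I(2) by blast
    have "x i = x j" if "x \<in> X" for x using fun_cong[OF j(2), of x] that by (simp add: r_def)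
    then show ?thesis using j(1) by blast
  qed
  then show thesis using that I(1) by blast
qed

text \<open>Deleting the connecting point \<open>xs ! i\<close> from each \<open>Ts ! i\<close> does
  not change the union: it remains in the next set, whose deleted point is a different one.\<close>

lemma card_Union_cycle:
  assumes cyc: "set_cycle X Ts" and T: "\<And>T'. T' \<in> set Ts \<Longrightarrow> finite T' \<and> card T' = q"
  shows "card (\<Union>(set Ts)) \<le> (q - 1) * length Ts"
proof -
  let ?l = "length Ts"
  have l: "2 \<le> ?l" using cyc unfolding set_cycle_def by (elim conjE)
  have "\<exists>xs. length xs = ?l \<and> distinct xs \<and> set xs \<subseteq> X \<and>
      (\<forall>i<?l. xs ! i \<in> Ts ! i \<inter> Ts ! (Suc i mod ?l))"
    using cyc unfolding set_cycle_def by (elim conjE)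
  then obtain xs where *: "length xs = ?l \<and> distinct xs \<and> set xs \<subseteq> X \<and>
      (\<forall>i<?l. xs ! i \<in> Ts ! i \<inter> Ts ! (Suc i mod ?l))" by (rule exE)
  then have xs: "length xs = ?l" "distinct xs" by simp_all
  have xs_mem: "xs ! i \<in> Ts ! i" "xs ! i \<in> Ts ! (Suc i mod ?l)" if "i < ?l" for i
    using * that by simp_all
  have "\<Union>(set Ts) \<subseteq> (\<Union>i<?l. Ts ! i - {xs ! i})"
  proof
    fix x assume "x \<in> \<Union>(set Ts)"
    then obtain i where i: "i < ?l" "x \<in> Ts ! i" by (auto simp: in_set_conv_nth)
    show "x \<in> (\<Union>i<?l. Ts ! i - {xs ! i})"
    proof (cases "x = xs ! i")
      case True
      let ?j = "Suc i mod ?l"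
      have j: "?j < ?l" "?j \<noteq> i" using l i(1) by (auto simp: mod_Suc)
      then have "x \<noteq> xs ! ?j" using True xs i(1) nth_eq_iff_index_eq[of xs i ?j] by simp
      moreover have "x \<in> Ts ! ?j" using xs_mem(2)[OF i(1)] True by simp
      ultimately show ?thesis using j(1) by blast
    qed (use i in blast)
  qed
  moreover have fin: "finite (Ts ! i)" "card (Ts ! i) = q" if "i < ?l" for i
    using T that by auto
  ultimately have "card (\<Union>(set Ts)) \<le> card (\<Union>i<?l. Ts ! i - {xs ! i})"
    by (intro card_mono) auto
  also have "\<dots> \<le> (\<Sum>i<?l. card (Ts ! i - {xs ! i}))" by (rule card_UN_le) simp
  also have "\<dots> = (\<Sum>i<?l. q - 1)"
    using fin xs_mem(1) by (intro sum.cong) auto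
  finally show ?thesis by (simp add: mult.commute)
qed

theorem theorem12:
  fixes T :: "(real ^ 'n) set"
    and F :: "('n + 'n) real_poly set"
    and g k :: nat
  assumes "finite T" and "card T \<ge> 3"
    and "countable F" and "respects_set F T"
    and "g > 0" and "k > 0"
  shows "\<exists>X :: (real ^ 'n) set. finite X \<and>
    respects_set F X \<and>
    (\<nexists>Ts. length Ts < g \<and> (\<forall>T'\<in>set Ts. homothetic_copy T T' \<and> T' \<subseteq> X) \<and>
       set_cycle X Ts) \<and>
    (\<forall>c :: real ^ 'n \<Rightarrow> nat. c ` X \<subseteq> {1..k} \<longrightarrow>
       (\<exists>T'. homothetic_copy T T' \<and> T' \<subseteq> X \<and> (\<exists>j. \<forall>x\<in>T'. c x = j)))"
proof -
  define q where "q = card T"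
  have q: "3 \<le> q" using assms(2) by (simp add: q_def)
  obtain \<tau> where \<tau>: "bij_betw \<tau> {..<q} T"
    using ex_bij_betw_nat_finite[OF assms(1)] by (auto simp: atLeast0LessThan q_def)
  have \<tau>T: "\<tau> b \<in> T" if "b < q" for b using \<tau> that unfolding bij_betw_def by auto
  have \<tau>_inj: "\<tau> b = \<tau> b' \<longleftrightarrow> b = b'" if "b < q" "b' < q" for b b'
    using \<tau> that unfolding bij_betw_def inj_on_def by auto
  obtain X where X: "finite X" "X \<subseteq> words q" "sparse q g X" "line_ramsey q k X"
    using sparse_Hales_Jewett[of g] q assms(6) unfolding sparse_HJ_def by (metis Suc_leI One_nat_def)
  have letter: "x i < q" if "x \<in> X" for x i using X(2) that by (auto simp: words_def)
  obtain I where I: "finite I" "\<And>i. \<exists>j\<in>I. \<forall>x\<in>X. x i = x j"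
    using finite_coordinates[OF X(1,2)] by blast
  define \<phi> where "\<phi> = (\<lambda>w x. wsum I (\<lambda>j. \<tau> (x j)) w)"
  text \<open>
    For \<open>\<phi> w x = b + l t\<close>, \<open>\<phi> w y = b + l t0\<close> and \<open>\<phi> w z = b + l t1\<close>, the weighted sum of the vectors
    \<open>D (x, y, z, t, t0, t1)\<close> vanishes; for \<open>t = t0\<close> it is \<open>\<phi> w x - \<phi> w y\<close>.
  \<close>
  define D where "D = (\<lambda>(x, y, z, t, t0, t1) (j :: nat). (\<tau> (x j) - \<tau> (y j)) -
      (((\<tau> (z j) - \<tau> (y j)) \<bullet> (t1 - t0)) / ((t1 - t0) \<bullet> (t1 - t0))) *\<^sub>R (t - t0))"
  \<comment> \<open>Each condition must hold for some weights, so only families that are nonzero at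
    a coordinate in \<open>I\<close> are kept.\<close>
  define \<D> where "\<D> = {d \<in> D ` (X \<times> X \<times> X \<times> T \<times> T \<times> T). \<exists>j\<in>I. d j \<noteq> 0}"
  define \<G>1 where "\<G>1 = (\<lambda>(f, x, y) w. eval_at_pair f (\<phi> w x) (\<phi> w y)) `
      (F \<times> {(x, y). x \<in> X \<and> y \<in> X \<and> x \<noteq> y})"
  define \<G>2 where "\<G>2 = (\<lambda>d w. wsum I d w \<bullet> wsum I d w) ` \<D>"
  have sep: "\<exists>j\<in>I. x j \<noteq> y j" if xy: "x \<in> X" "y \<in> X" "x \<noteq> y" for x y
  proof -
    obtain i where "x i \<noteq> y i" using xy(3) by auto
    then show ?thesis using I(2)[of i] xy by metis
  qed
  have "\<exists>w. (\<forall>i. w i > 0) \<and> (\<forall>G\<in>\<G>1 \<union> \<G>2. G w \<noteq> 0)"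
  proof (rule generic_positive[OF I(1)])
    have "countable (F \<times> {(x, y). x \<in> X \<and> y \<in> X \<and> x \<noteq> y})"
    proof (rule countable_SIGMA[OF assms(3)])
      have "finite (X \<times> X)" using X(1) by simp
      then show "countable {(x, y). x \<in> X \<and> y \<in> X \<and> x \<noteq> y}"
        by (intro countable_finite) (auto elim: rev_finite_subset)
    qed
    then have "countable \<G>1" unfolding \<G>1_def by (rule countable_image)
    moreover have "countable \<D>"
      unfolding \<D>_def using X(1) assms(1) by (intro countable_finite) auto
    then have "countable \<G>2" unfolding \<G>2_def by (rule countable_image)
    ultimately show "countable (\<G>1 \<union> \<G>2)" by blast
  next
    fix G assume "G \<in> \<G>1 \<union> \<G>2"
    then show "sep_poly G"
      unfolding \<G>1_def \<G>2_def \<phi>_def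
      using sep_poly_eval_at_pair sep_poly_wsum_inner by auto
  next
    fix G assume "G \<in> \<G>1 \<union> \<G>2"
    then show "\<exists>w. G w \<noteq> 0"
    proof
      assume "G \<in> \<G>1"
      then obtain f x y where G: "G = (\<lambda>w. eval_at_pair f (\<phi> w x) (\<phi> w y))"
        "f \<in> F" "x \<in> X" "y \<in> X" "x \<noteq> y" unfolding \<G>1_def by auto
      obtain j where j: "j \<in> I" "x j \<noteq> y j" using sep G by blast
      \<comment> \<open>At the unit vector \<phi> maps \<open>x\<close> and \<open>y\<close> to two
        distinct points of \<open>T\<close>, which the polynomials respect.\<close>
      have "eval_at_pair f (\<tau> (x j)) (\<tau> (y j)) \<noteq> 0"
        using assms(4) G j \<tau>T \<tau>_inj letter unfolding respects_set_def by simp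
      then have "G (\<lambda>i. if i = j then 1 else 0) \<noteq> 0"
        unfolding G(1) \<phi>_def wsum_unit[OF I(1) j(1)] .
      then show ?thesis by blast
    next
      assume "G \<in> \<G>2"
      then obtain d where dD: "G = (\<lambda>w. wsum I d w \<bullet> wsum I d w)" "d \<in> \<D>"
        unfolding \<G>2_def by blast
      then obtain j where d: "G = (\<lambda>w. wsum I d w \<bullet> wsum I d w)" "j \<in> I" "d j \<noteq> 0"
        unfolding \<D>_def by blast
      then have "G (\<lambda>i. if i = j then 1 else 0) \<noteq> 0"
        unfolding d(1) wsum_unit[OF I(1) d(2)] using d(3) by simp
      then show ?thesis by blast
    qed
  next
    fix G and w w' :: "nat \<Rightarrow> real"
    assume G: "G \<in> \<G>1 \<union> \<G>2" and w: "\<And>i. i \<in> I \<Longrightarrow> w i = w' i"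
    have "wsum I d w = wsum I d w'" for d :: "nat \<Rightarrow> real ^ 'n" using wsum_cong w by blast
    then show "G w = G w'" using G unfolding \<G>1_def \<G>2_def \<phi>_def by auto
  qed
  then obtain w where w: "\<And>i. w i > 0" "\<And>G. G \<in> \<G>1 \<union> \<G>2 \<Longrightarrow> G w \<noteq> 0" by blast
  define p where "p = \<phi> w"
  have eval: "eval_at_pair f (p x) (p y) \<noteq> 0" if "f \<in> F" "x \<in> X" "y \<in> X" "x \<noteq> y" for f x y
    using w(2)[of "\<lambda>w. eval_at_pair f (\<phi> w x) (\<phi> w y)"] that unfolding \<G>1_def p_def
    by (auto simp: image_iff)
  have wD: "p x - p y - (((p z - p y) \<bullet> (t1 - t0)) / ((t1 - t0) \<bullet> (t1 - t0))) *\<^sub>R (t - t0) \<noteq> 0"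
    if "x \<in> X" "y \<in> X" "z \<in> X" "t \<in> T" "t0 \<in> T" "t1 \<in> T" "j \<in> I"
      "D (x, y, z, t, t0, t1) j \<noteq> 0" for x y z t t0 t1 j
  proof -
    have "D (x, y, z, t, t0, t1) \<in> \<D>" using that unfolding \<D>_def by blast
    then have "(\<lambda>w. wsum I (D (x, y, z, t, t0, t1)) w \<bullet> wsum I (D (x, y, z, t, t0, t1)) w) \<in> \<G>2"
      unfolding \<G>2_def by blast
    then have "wsum I (D (x, y, z, t, t0, t1)) w \<noteq> 0" using w(2) by fastforce
    then show ?thesis
      unfolding D_def prod.case wsum_diff wsum_inner_scale p_def \<phi>_def .
  qed
  have inj_p: "inj_on p X"
  proof (rule inj_onI, rule ccontr)
    fix x y assume xy: "x \<in> X" "y \<in> X" "p x = p y" "x \<noteq> y"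
    obtain j where j: "j \<in> I" "x j \<noteq> y j" using sep xy by blast
    obtain t where "t \<in> T" using \<tau>T[of 0] q by auto
    then show False
      using wD[of x y y t t t j] xy j \<tau>_inj letter unfolding D_def by simp
  qed
  have copy: "qline q {x \<in> X. p x \<in> T'} \<and> p ` {x \<in> X. p x \<in> T'} = T'"
    if T': "homothetic_copy T T'" "T' \<subseteq> p ` X" for T'
  proof
    obtain b l where bl: "l > 0" "T' = (\<lambda>t. b + l *\<^sub>R t) ` T"
      using T'(1) unfolding homothetic_copy_def homothetic_map_def by blast
    have "\<forall>t\<in>T. \<exists>x\<in>X. p x = b + l *\<^sub>R t" using T'(2) unfolding bl(2) by (metis imageE image_subset_iff)
    then obtain \<psi> where \<psi>: "\<And>t. t \<in> T \<Longrightarrow> \<psi> t \<in> X" "\<And>t. t \<in> T \<Longrightarrow> p (\<psi> t) = b + l *\<^sub>R t"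
      by metis
    have img: "{x \<in> X. p x \<in> T'} = \<psi> ` T"
    proof (intro equalityI subsetI)
      fix x assume "x \<in> {x \<in> X. p x \<in> T'}"
      then obtain t where t: "x \<in> X" "t \<in> T" "p x = b + l *\<^sub>R t" unfolding bl(2) by blast
      then have "p x = p (\<psi> t)" using \<psi>(2) by simp
      then have "x = \<psi> t" using inj_onD[OF inj_p] t(1) \<psi>(1)[OF t(2)] by blast
      then show "x \<in> \<psi> ` T" using t(2) by blast
    qed (use \<psi> bl(2) in auto)
    show "p ` {x \<in> X. p x \<in> T'} = T'" using T'(2) by auto
    have inj_\<psi>: "inj_on \<psi> T"
    proof (rule inj_onI)
      fix t t' assume "t \<in> T" "t' \<in> T" "\<psi> t = \<psi> t'"
      then have "l *\<^sub>R t = l *\<^sub>R t'" using \<psi>(2) by (metis add_left_cancel)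
      then show "t = t'" using bl(1) by simp
    qed
    have "(\<forall>x\<in>\<psi> ` T. \<forall>y\<in>\<psi> ` T. x i = y i) \<or> inj_on (\<lambda>x. x i) (\<psi> ` T)" for i
    proof -
      obtain j where j: "j \<in> I" "\<And>x. x \<in> X \<Longrightarrow> x i = x j" using I(2) by blast
      define t0 where "t0 = \<tau> 0"
      define t1 where "t1 = \<tau> 1"
      have t01: "t0 \<in> T" "t1 \<in> T" "t0 \<noteq> t1"
        using \<tau>T \<tau>_inj[of 0 1] q by (auto simp: t0_def t1_def)
      \<comment> \<open>If the copy were not homothetic in coordinate \<open>j\<close>, then
        \<open>D\<close> would be nonzero there and \<open>wD\<close> would contradict the relation
        among the projected points. The factor \<mu> may be 0; this is the constant case.\<close>
      define \<mu> where "\<mu> = ((\<tau> (\<psi> t1 j) - \<tau> (\<psi> t0 j)) \<bullet> (t1 - t0)) / ((t1 - t0) \<bullet> (t1 - t0))"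
      have \<mu>: "\<tau> (\<psi> t j) = \<tau> (\<psi> t0 j) + \<mu> *\<^sub>R (t - t0)" if t: "t \<in> T" for t
      proof -
        have d: "p (\<psi> s) - p (\<psi> t0) = l *\<^sub>R (s - t0)" if "s \<in> T" for s
          using \<psi>(2) t01 that by (simp add: algebra_simps)
        \<comment> \<open>The ratio \<open>l\<close> is recovered from the images of
          \<open>t0\<close> and \<open>t1\<close>; this explains the quotient in
          \<open>D\<close>.\<close>
        have "((p (\<psi> t1) - p (\<psi> t0)) \<bullet> (t1 - t0)) / ((t1 - t0) \<bullet> (t1 - t0)) = l"
          unfolding d[OF t01(2)] using t01(3) by simp
        then have "p (\<psi> t) - p (\<psi> t0) -
            (((p (\<psi> t1) - p (\<psi> t0)) \<bullet> (t1 - t0)) / ((t1 - t0) \<bullet> (t1 - t0))) *\<^sub>R (t - t0) = 0"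
          using d[OF t] by simp
        then have "D (\<psi> t, \<psi> t0, \<psi> t1, t, t0, t1) j = 0"
          using wD[OF \<psi>(1)[OF t] \<psi>(1)[OF t01(1)] \<psi>(1)[OF t01(2)] t t01(1,2) j(1)] by blast
        then show ?thesis unfolding D_def \<mu>_def by (simp add: algebra_simps)
      qed
      show ?thesis
      proof (cases "\<mu> = 0")
        case True
        have "\<psi> t i = \<psi> t0 i" if "t \<in> T" for t
          using \<mu>[OF that] True \<tau>_inj letter \<psi>(1) t01(1) that
            j(2)[OF \<psi>(1)[OF that]] j(2)[OF \<psi>(1)[OF t01(1)]] by simp
        then show ?thesis by simp
      next
        case False
        have "t = t'" if "t \<in> T" "t' \<in> T" "\<psi> t i = \<psi> t' i" for t t'
        proof -
          have "\<psi> t j = \<psi> t' j" using that j(2) \<psi>(1) by metis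
          then have "\<mu> *\<^sub>R (t - t0) = \<mu> *\<^sub>R (t' - t0)" using \<mu> that by (metis add_left_cancel)
          then show ?thesis using False by simp
        qed
        then show ?thesis by (auto simp: inj_on_def)
      qed
    qed
    moreover have "card (\<psi> ` T) = q" using card_image[OF inj_\<psi>] by (simp add: q_def)
    ultimately show "qline q {x \<in> X. p x \<in> T'}" unfolding img qline_def by blast
  qed
  show ?thesis
  proof (intro exI[of _ "p ` X"] conjI)
    show "finite (p ` X)" using X(1) by simp
    show "respects_set F (p ` X)" unfolding respects_set_def using eval by auto
    show "\<nexists>Ts. length Ts < g \<and> (\<forall>T'\<in>set Ts. homothetic_copy T T' \<and> T' \<subseteq> p ` X) \<and>
       set_cycle (p ` X) Ts"
    proof
      assume "\<exists>Ts. length Ts < g \<and> (\<forall>T'\<in>set Ts. homothetic_copy T T' \<and> T' \<subseteq> p ` X) \<and>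
       set_cycle (p ` X) Ts"
      then obtain Ts where Ts: "length Ts < g" "set_cycle (p ` X) Ts"
        "\<And>T'. T' \<in> set Ts \<Longrightarrow> homothetic_copy T T'" "\<And>T'. T' \<in> set Ts \<Longrightarrow> T' \<subseteq> p ` X"
        by blast
      \<comment> \<open>Pulled back to \<open>X\<close>, the copies are quasi-lines. Sparseness
        bounds their union from below, and the cycle bounds it from above by one less.\<close>
      define B where "B = (\<lambda>T'. {x \<in> X. p x \<in> T'})"
      have B: "qline q (B T')" "p ` B T' = T'" if "T' \<in> set Ts" for T'
        using copy[OF Ts(3,4)[OF that]] unfolding B_def by blast+
      have BX: "B T' \<subseteq> X" for T' by (auto simp: B_def)
      have "inj_on B (set Ts)" using B(2) by (metis inj_onI)
      then have card_B: "card (B ` set Ts) = length Ts"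
        using Ts(2) card_image distinct_card unfolding set_cycle_def by metis
      have "set Ts \<noteq> {}" using Ts(2) unfolding set_cycle_def by auto
      then have "(q - 1) * card (B ` set Ts) + 1 \<le> card (\<Union>(B ` set Ts))"
        using X(3) card_B Ts(1) B(1) BX by (intro sparseD) auto
      also have "\<dots> = card (p ` \<Union>(B ` set Ts))"
        using inj_p BX by (intro card_image[symmetric]) (auto intro: inj_on_subset)
      also have "p ` \<Union>(B ` set Ts) = \<Union>(set Ts)" using B(2) by (simp add: image_UN)
      also have "card (\<Union>(set Ts)) \<le> (q - 1) * length Ts"
      proof (rule card_Union_cycle[OF Ts(2)])
        fix T' assume T': "T' \<in> set Ts"
        have "card (p ` B T') = card (B T')"
          using inj_p BX by (intro card_image) (auto intro: inj_on_subset)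
        then show "finite T' \<and> card T' = q"
          using B[OF T'] q unfolding qline_def by (metis card.infinite not_numeral_le_zero)
      qed
      finally show False using card_B by simp
    qed
    show "\<forall>c :: real ^ 'n \<Rightarrow> nat. c ` p ` X \<subseteq> {1..k} \<longrightarrow>
       (\<exists>T'. homothetic_copy T T' \<and> T' \<subseteq> p ` X \<and> (\<exists>j. \<forall>x\<in>T'. c x = j))"
    proof (intro allI impI)
      fix c :: "real ^ 'n \<Rightarrow> nat" assume c: "c ` p ` X \<subseteq> {1..k}"
      \<comment> \<open>Colours \<open>1..k\<close> are shifted to start at 0; as they are positive,
        the truncated subtraction is injective on them.\<close>
      have "c (p x) - 1 < k" if "x \<in> X" for x using c that by fastforce
      then have "mono_line q (\<lambda>x. c (p x) - 1) X" by (rule line_ramseyD[OF X(4)])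
      then obtain A a j where A: "A \<noteq> {}" "\<And>b. b < q \<Longrightarrow> pt A a b \<in> X"
        "\<And>b. b < q \<Longrightarrow> c (p (pt A a b)) - 1 = j"
        by (rule mono_lineE) blast
      have colour: "c (p (pt A a b)) = Suc j" if "b < q" for b
        using A(3)[OF that] A(2)[OF that] c by fastforce
      \<comment> \<open>An active coordinate may lie outside \<open>I\<close>. Its representative
        \<open>i'\<close> in \<open>I\<close> is active as well, because the words at letters 0 and
        1 differ there; hence the ratio \<open>l\<close> is a nonempty sum of positive
        weights.\<close>
      obtain i where "i \<in> A" using A(1) by blast
      obtain i' where i': "i' \<in> I" "\<And>x. x \<in> X \<Longrightarrow> x i = x i'" using I(2) by blast
      have "i' \<in> A"
        using i'(2)[OF A(2), of 0] i'(2)[OF A(2), of 1] q \<open>i \<in> A\<close>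
        by (auto simp: pt_def split: if_splits)
      define l where "l = (\<Sum>i\<in>I \<inter> A. w i)"
      have "l > 0" unfolding l_def
        using w(1) I(1) i'(1) \<open>i' \<in> A\<close> by (intro sum_pos) auto
      define b0 where "b0 = (\<Sum>i\<in>I - A. w i *\<^sub>R \<tau> (a i))"
      have p: "p (pt A a b) = b0 + l *\<^sub>R \<tau> b" for b
      proof -
        have "p (pt A a b) = (\<Sum>i\<in>I - A. w i *\<^sub>R \<tau> (pt A a b i)) + (\<Sum>i\<in>I \<inter> A. w i *\<^sub>R \<tau> (pt A a b i))"
          unfolding p_def \<phi>_def wsum_def
          by (subst sum.Int_Diff[OF I(1), of _ A]) (rule add.commute)
        also have "(\<Sum>i\<in>I - A. w i *\<^sub>R \<tau> (pt A a b i)) = b0"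
          unfolding b0_def by (rule sum.cong) (auto simp: pt_def)
        also have "(\<Sum>i\<in>I \<inter> A. w i *\<^sub>R \<tau> (pt A a b i)) = (\<Sum>i\<in>I \<inter> A. w i *\<^sub>R \<tau> b)"
          by (rule sum.cong) (auto simp: pt_def)
        finally show ?thesis by (simp add: l_def scaleR_sum_left)
      qed
      have T: "T = \<tau> ` {..<q}" using \<tau> unfolding bij_betw_def by blast
      have img: "(\<lambda>t. b0 + l *\<^sub>R t) ` T = (\<lambda>b. p (pt A a b)) ` {..<q}"
        unfolding T image_image p ..
      have "homothetic_copy T ((\<lambda>t. b0 + l *\<^sub>R t) ` T)"
        unfolding homothetic_copy_def homothetic_map_def using \<open>l > 0\<close> by blast
      then show "\<exists>T'. homothetic_copy T T' \<and> T' \<subseteq> p ` X \<and> (\<exists>j. \<forall>x\<in>T'. c x = j)"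
        using A(2) colour unfolding img by blast
    qed
  qed
qed

end
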